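(* Let $d\in\mathbb N$ and $\varepsilon>0$. There exist a suitably large constant $C$ and a constant $C_1$, both depending only on $d$ and $\varepsilon$, such that the following holds. Let $N\in\mathbb N$, let $\{a_{\mathbf n}\}_{\mathbf n\in S_{d,N}}$ be complex numbers with $\sum_{\mathbf n}|a_{\mathbf n}|^2=1$, let $$F(\mathbf x,t)=\sum_{\mathbf n\in S_{d,N}}a_{\mathbf n}e^{2\pi i\mathbf n\cdot\mathbf x}e^{2\pi i|\mathbf n|^2t},\qquad (\mathbf x,t)\in\mathbb T^d\times\mathbb T,$$ and let $E_\lambda=\{(\mathbf x,t)\in\mathbb T^{d+1}:|F(\mathbf x,t)|>\lambda\}$. If $\lambda\ge CN^{d/4}$, then $$|E_\lambda|\le C_1N^{\varepsilon}\lambda^{-\frac{2(d+2)}{d}} .$$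
   Context: $\mathbb T=\mathbb R/\mathbb Z$ with normalized Lebesgue measure; $|E|$ denotes the Lebesgue measure of $E\subset\mathbb T^{d+1}$. $S_{d,N}=\{(n_1,\dots,n_d)\in\mathbb Z^d:|n_j|\le N,\ 1\le j\le d\}$ and $|\mathbf n|^2=n_1^2+\cdots+n_d^2$. *)

theory Defs
  imports "HOL-Analysis.Analysis"
begin

text \<open>
  The dimension d is \<open>CARD('d)\<close>. The torus \<open>\<T>\<^sup>d \<times> \<T>\<close> is represented by the fundamental domain
  \<open>[0,1)\<^sup>d \<times> [0,1)\<close> of the action of the integer lattice, on which the normalized Lebesgue
  measure of the torus is the ordinary Lebesgue measure.
\<close>
definition torus :: "((real ^ 'd::finite) \<times> real) set" where
  "torus = {(x, t). (\<forall>j. 0 \<le> x $ j \<and> x $ j < 1) \<and> 0 \<le> t \<and> t < 1}"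

definition freq_box :: "nat \<Rightarrow> (int ^ 'd::finite) set" where
  "freq_box N = {n. \<forall>j. \<bar>n $ j\<bar> \<le> int N}"

definition int_dot :: "int ^ 'd::finite \<Rightarrow> real ^ 'd \<Rightarrow> real" where
  "int_dot n x = (\<Sum>j\<in>UNIV. of_int (n $ j) * x $ j)"

definition int_norm_sq :: "int ^ 'd::finite \<Rightarrow> int" where
  "int_norm_sq n = (\<Sum>j\<in>UNIV. (n $ j)\<^sup>2)"

definition exp_sum :: "nat \<Rightarrow> (int ^ 'd::finite \<Rightarrow> complex) \<Rightarrow> real ^ 'd \<Rightarrow> real \<Rightarrow> complex" where
  "exp_sum N a x t =
     (\<Sum>n\<in>freq_box N. a n * exp (2 * of_real pi * \<i> * of_real (int_dot n x))
                           * exp (2 * of_real pi * \<i> * of_int (int_norm_sq n) * of_real t))"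

definition level_set ::
    "nat \<Rightarrow> (int ^ 'd::finite \<Rightarrow> complex) \<Rightarrow> real \<Rightarrow> ((real ^ 'd) \<times> real) set" where
  "level_set N a lam = {(x, t) \<in> torus. cmod (exp_sum N a x t) > lam}"

lemma finite_freq_box: "finite (freq_box N :: (int ^ 'd::finite) set)"
proof -
  have "finite (Pi\<^sub>E (UNIV :: 'd set) (\<lambda>_. {- int N..int N}))"
    by (intro finite_PiE) auto
  moreover have "(freq_box N :: (int ^ 'd) set)
      \<subseteq> vec_lambda ` Pi\<^sub>E (UNIV :: 'd set) (\<lambda>_. {- int N..int N})"
  proof
    fix n :: "int ^ 'd" assume "n \<in> freq_box N"
    then have "vec_nth n \<in> Pi\<^sub>E (UNIV :: 'd set) (\<lambda>_. {- int N..int N})"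
      by (simp add: freq_box_def PiE_iff abs_le_iff minus_le_iff)
    moreover have "n = vec_lambda (vec_nth n)" by simp
    ultimately show "n \<in> vec_lambda ` Pi\<^sub>E (UNIV :: 'd set) (\<lambda>_. {- int N..int N})" by blast
  qed
  ultimately show ?thesis by (meson finite_imageI finite_subset)
qed

lemma torus_borel: "torus \<in> sets (borel :: ((real ^ 'd::finite) \<times> real) measure)"
proof -
  have eq: "(torus :: ((real ^ 'd) \<times> real) set) =
      (\<Inter>j. {p. 0 \<le> fst p $ j}) \<inter> (\<Inter>j. {p. fst p $ j < 1}) \<inter> {p. 0 \<le> snd p} \<inter> {p. snd p < 1}"
    by (auto simp: torus_def)
  have "closed (\<Inter>j. {p :: (real ^ 'd) \<times> real. 0 \<le> fst p $ j})"
    "closed {p :: (real ^ 'd) \<times> real. 0 \<le> snd p}"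
    by (intro closed_INT ballI closed_Collect_le continuous_intros)+
  moreover have "open (\<Inter>j. {p :: (real ^ 'd) \<times> real. fst p $ j < 1})"
    "open {p :: (real ^ 'd) \<times> real. snd p < 1}"
    by (intro open_INT finite ballI open_Collect_less continuous_intros)+
  ultimately show ?thesis unfolding eq
    by (intro sets.Int borel_closed borel_open)
qed

lemma level_set_borel:
  "level_set N a lam \<in> sets (borel :: ((real ^ 'd::finite) \<times> real) measure)"
proof -
  have eq: "level_set N a lam = torus \<inter> {p. lam < cmod (exp_sum N a (fst p) (snd p))}"
    by (auto simp: level_set_def)
  have "open {p :: (real ^ 'd) \<times> real. lam < cmod (exp_sum N a (fst p) (snd p))}"
    unfolding exp_sum_def int_dot_def by (intro open_Collect_less continuous_intros)
  then show ?thesis unfolding eq by (intro sets.Int torus_borel borel_open)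
qed

end

(*
  Bourgain's circle-method argument, with the decomposition of the Weyl kernel due to Hu and Li.
  By duality it suffices to bound the sum over the frequencies n of
  the product of W(n) and the square of |S(n, |n|^2)|,
  where S is the Fourier transform of a unimodular function on the level set
  and W is a product of tent functions dominating the frequency box.  Multiply the kernel
  by the indicator of the disjoint arcs of radius 1/(4X^2) around the reduced fractions a/q with
  X/4 < q <= X, where X >= 64N.  On these arcs Weyl's inequality (without logarithmic loss, thanks to
  the smooth weight) bounds the kernel by a multiple of (N sqrt X)^d.  The nonzero Fourier coefficients of
  the indicator are bounded by X^(2 delta - 1) through Ramanujan sums and the divisor bound, whereas
  the zeroth one, the total length of the arcs, is bounded below.  The choice X ~ lam^(4/d) balances the two
  contributions, and X >= 64N is exactly the hypothesis on lam.

  All Fourier analysis takes place on a finite grid of mesh 1/M on which the arcs have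
  endpoints, so that only finite sums occur; the measure of the level set is recovered by
  averaging over the translates of the grid.
*)
theory Submission
  imports Defs "HOL-Number_Theory.Number_Theory"
begin

section \<open>The additive character and Weyl differencing\<close>

text \<open>The threshold for lambda carries no power N^eps, while the conclusion does, and this
  decides where losses are allowed. A logarithm in the Weyl bound would enter to the power d and
  raise the threshold. A loss X^(2 delta) in the Fourier coefficients only multiplies the final
  measure, and N^eps absorbs it because the level set E is empty unless lambda < (2N+1)^(d/2). Up to
  constants, the duality inequality reads lambda^2 |E|^2 <= X^(d/2) |E|^2 + X^(2 delta - 1) |E|.
  When X is a small multiple of lambda^(4/d), the left side absorbs the first term, and the second
  leaves |E| <= X^(2 delta) lambda^(-2 - 4/d). Only the zeroth Fourier coefficient of the arcs has
  to be large, so they need not cover the circle: one range of denominators suffices and no minor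
  arcs arise. All centres a/q must be grid points, which forces M to be divisible by every q <= X;
  every estimate is therefore uniform in M.\<close>

definition e2pi :: "real \<Rightarrow> complex" where
  "e2pi x = cis (2 * pi * x)"

lemma e2pi_0 [simp]: "e2pi 0 = 1"
  by (simp add: e2pi_def)

lemma e2pi_add: "e2pi (x + y) = e2pi x * e2pi y"
  by (simp add: e2pi_def cis_mult distrib_left)

lemma e2pi_minus: "e2pi (- x) = cnj (e2pi x)"
  by (simp add: e2pi_def cis_cnj)

lemma e2pi_diff: "e2pi (x - y) = e2pi x * cnj (e2pi y)"
  using e2pi_add[of x "- y"] by (simp add: e2pi_minus)

lemma norm_e2pi [simp]: "norm (e2pi x) = 1"
  by (simp add: e2pi_def)

lemma e2pi_of_int [simp]: "e2pi (of_int n) = 1"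
  by (simp add: e2pi_def cis_multiple_2pi)

lemma e2pi_sum: "e2pi (\<Sum>i\<in>A. f i) = (\<Prod>i\<in>A. e2pi (f i))"
  by (induction A rule: infinite_finite_induct) (auto simp: e2pi_add)

lemma e2pi_cong: "x - y \<in> \<int> \<Longrightarrow> e2pi x = e2pi y"
  using e2pi_add[of y "x - y"] by (auto elim: Ints_cases)

lemma norm_one_minus_e2pi: "norm (1 - e2pi x) = 2 * \<bar>sin (pi * x)\<bar>"
proof -
  have *: "(1 - (1 - 2 * s\<^sup>2))\<^sup>2 + (2 * s * c)\<^sup>2 = 4 * s\<^sup>2 * (s\<^sup>2 + c\<^sup>2)" for s c :: real
    by (simp add: power2_eq_square algebra_simps)
  have "(norm (1 - e2pi x))\<^sup>2 = (1 - cos (2 * (pi * x)))\<^sup>2 + (sin (2 * (pi * x)))\<^sup>2"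
    by (simp add: e2pi_def cmod_power2 mult.assoc)
  also have "\<dots> = 4 * (sin (pi * x))\<^sup>2 * ((sin (pi * x))\<^sup>2 + (cos (pi * x))\<^sup>2)"
    unfolding cos_double_sin sin_double by (rule *)
  also have "\<dots> = (2 * \<bar>sin (pi * x)\<bar>)\<^sup>2"
    by (simp add: power_mult_distrib)
  finally show ?thesis
    by (rule power2_eq_imp_eq) auto
qed

lemma norm_e2pi_diff_le: "norm (e2pi x - e2pi y) \<le> 2 * pi * \<bar>x - y\<bar>"
proof -
  have "e2pi y = e2pi x * e2pi (y - x)"
    using e2pi_add[of x "y - x"] by simp
  then have "e2pi x - e2pi y = e2pi x * (1 - e2pi (y - x))"
    by (simp only: right_diff_distrib mult_1_right)
  then have "norm (e2pi x - e2pi y) = 2 * \<bar>sin (pi * (y - x))\<bar>"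
    by (simp add: norm_mult norm_one_minus_e2pi)
  also have "\<dots> \<le> 2 * \<bar>pi * (y - x)\<bar>"
    by (intro mult_left_mono abs_sin_x_le_abs_x) auto
  finally show ?thesis by (simp add: abs_mult abs_minus_commute)
qed

text \<open>Concavity puts the graph of the sine on [0, pi/2] above its chord.\<close>

lemma jordan_sin_ge:
  assumes "0 \<le> x" "x \<le> pi / 2"
  shows "2 / pi * x \<le> sin x"
proof -
  have "concave_on {0..pi / 2} sin"
    by (rule f''_le0_imp_concave[where f' = cos and f'' = "\<lambda>x. - sin x"])
       (auto intro!: derivative_eq_intros sin_ge_zero)
  then have "sin ((1 - 2 / pi * x) *\<^sub>R 0 + (2 / pi * x) *\<^sub>R (pi / 2))
      \<ge> (1 - 2 / pi * x) * sin 0 + (2 / pi * x) * sin (pi / 2)"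
    using assms by (intro concave_onD) (auto simp: field_simps)
  then show ?thesis by simp
qed

text \<open>In this range |x| is the distance from x to the nearest integer, so the bound controls
  the denominators of geometric sums. Where necessary, \<open>symmetric_residue\<close> first brings
  the argument into the range.\<close>

lemma norm_one_minus_e2pi_ge:
  assumes "\<bar>x\<bar> \<le> 1 / 2"
  shows "4 * \<bar>x\<bar> \<le> norm (1 - e2pi x)"
proof -
  have "2 / pi * (pi * \<bar>x\<bar>) \<le> sin (pi * \<bar>x\<bar>)"
    by (intro jordan_sin_ge) (use assms in auto)
  also have "\<dots> \<le> \<bar>sin (pi * x)\<bar>"
    by (cases "x \<ge> 0") auto
  finally show ?thesis by (simp add: norm_one_minus_e2pi)
qed

lemma symmetric_residue:
  fixes k m :: int
  assumes "m > 0"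
  obtains r where "\<bar>2 * r\<bar> \<le> m" "m dvd k - r"
proof
  \<comment> \<open>Shifting by \<open>m div 2\<close> before the reduction and back after it
    centres the residues at 0.\<close>
  let ?r = "(k + m div 2) mod m - m div 2"
  have "(k + m div 2) mod m < m" "(k + m div 2) mod m \<ge> 0" using assms by auto
  moreover have "2 * (m div 2) \<le> m" "m \<le> 2 * (m div 2) + 1" by presburger+
  moreover have "\<bar>2 * (x - y)\<bar> \<le> m" if "x < m" "0 \<le> x" "2 * y \<le> m" "m \<le> 2 * y + 1" for x y
    using that by presburger
  ultimately show "\<bar>2 * ?r\<bar> \<le> m" by blast
  have "k - ?r = (k + m div 2) - (k + m div 2) mod m" by simp
  then show "m dvd k - ?r" by (simp only: dvd_minus_mod)
qed

text \<open>Translating the window by one step multiplies the sum by w, so it vanishes unless w = 1.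
  The start \<open>a\<close> is free because windows starting at 1 and windows symmetric about 0
  both occur later.\<close>

lemma sum_e2pi_complete:
  fixes k m a :: int
  assumes "m > 0"
  shows "(\<Sum>j\<in>{a..<a + m}. e2pi (of_int (k * j) / of_int m)) = (if m dvd k then of_int m else 0)"
proof -
  define w where "w = e2pi (of_int k / of_int m)"
  define f where "f j = e2pi (of_int (k * j) / of_int m)" for j
  have shift: "f (j + m) = f j" for j
  proof -
    have "of_int (k * (j + m)) / of_int m = of_int (k * j) / of_int m + (of_int k :: real)"
      using assms by (simp add: distrib_left add_divide_distrib)
    then show ?thesis by (simp only: f_def e2pi_add e2pi_of_int mult_1_right)
  qed
  have inv: "(\<Sum>j\<in>{a..<a + m}. f j) = (\<Sum>j\<in>{a + 1..<a + 1 + m}. f j)"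
  proof -
    have "{a..<a + m} = insert a {a + 1..<a + m}" "{a + 1..<a + 1 + m} = insert (a + m) {a + 1..<a + m}"
      using assms by auto
    then show ?thesis by (simp only: sum.insert finite_atLeastLessThan_int atLeastLessThan_iff) (simp add: shift)
  qed
  also have "\<dots> = (\<Sum>j\<in>{a..<a + m}. f (j + 1))"
    by (rule sum.reindex_bij_witness[of _ "\<lambda>j. j + 1" "\<lambda>j. j - 1"]) auto
  also have "\<dots> = w * (\<Sum>j\<in>{a..<a + m}. f j)"
    by (simp add: sum_distrib_left f_def w_def flip: e2pi_add)
       (intro sum.cong refl arg_cong[of _ _ e2pi], simp add: distrib_left add_divide_distrib)
  finally have eq: "(1 - w) * (\<Sum>j\<in>{a..<a + m}. f j) = 0"
    unfolding left_diff_distrib mult_1_left right_minus_eq .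
  show ?thesis
  proof (cases "m dvd k")
    case True
    then obtain c where c: "k = m * c" by auto
    have "f j = 1" for j
      using assms e2pi_of_int[of "c * j"] by (simp add: f_def c mult.assoc)
    then show ?thesis using True assms by (simp add: f_def)
  next
    case False
    \<comment> \<open>The centred residue gives w = e(r/m) with 0 < |r/m| <= 1/2, and the chord
      bound then excludes w = 1.\<close>
    obtain r where r: "\<bar>2 * r\<bar> \<le> m" and dvd: "m dvd k - r"
      using symmetric_residue[OF assms] by blast
    then have "r \<noteq> 0" using False by auto
    have w: "w = e2pi (of_int r / of_int m)"
      unfolding w_def
    proof (rule e2pi_cong)
      obtain c where "k - r = m * c" using dvd by auto
      then have "of_int k - of_int r = (of_int m * of_int c :: real)"
        unfolding of_int_diff[symmetric] of_int_mult[symmetric] by (rule arg_cong)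
      then have "of_int k / of_int m - of_int r / of_int m = (of_int c :: real)"
        using assms by (simp add: diff_divide_distrib[symmetric])
      then show "of_int k / of_int m - of_int r / of_int m \<in> (\<int> :: real set)"
        by (simp only: Ints_of_int)
    qed
    have "\<bar>of_int r / of_int m :: real\<bar> \<le> 1 / 2"
      using r assms by (simp add: field_simps)
    from norm_one_minus_e2pi_ge[OF this] have "norm (1 - w) \<ge> 4 * \<bar>of_int r / of_int m\<bar>"
      unfolding w .
    moreover have "\<bar>of_int r / of_int m :: real\<bar> > 0" using \<open>r \<noteq> 0\<close> assms by simp
    ultimately have "norm (1 - w) > 0" by linarith
    then have "1 - w \<noteq> 0" by auto
    then show ?thesis using eq False by (simp add: f_def)
  qed
qed

text \<open>The Fejer weight: the autocorrelation of the indicator of 2N consecutive integers. It is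
  piecewise linear with three kinks, so its exponential sums decay quadratically; a sharp cutoff
  would give linear decay and hence a logarithm after summation.\<close>

definition tent :: "nat \<Rightarrow> int \<Rightarrow> int" where
  "tent N m = max 0 (2 * int N - \<bar>m\<bar>)"

lemma tent_nonneg: "0 \<le> tent N m"
  and tent_le: "tent N m \<le> 2 * int N"
  and tent_ge: "\<bar>m\<bar> \<le> int N \<Longrightarrow> int N \<le> tent N m"
  and tent_eq_0: "2 * int N \<le> \<bar>m\<bar> \<Longrightarrow> tent N m = 0"
  by (auto simp: tent_def)

lemma tent_lipschitz: "\<bar>tent N (m + 1) - tent N m\<bar> \<le> 1" "\<bar>tent N (m - 1) - tent N m\<bar> \<le> 1"
  by (auto simp: tent_def)

lemma tent_second_difference:
  "\<bar>tent N (m + 1) + tent N (m - 1) - 2 * tent N m\<bar>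
    \<le> (if m \<in> {0, 2 * int N, - 2 * int N} then 2 else 0)"
proof -
  consider "m = 0" | "m > 0" | "m < 0" by linarith
  then show ?thesis
  proof cases
    case 1
    then show ?thesis by (auto simp: tent_def max_def)
  next
    case 2
    then have "\<bar>m + 1\<bar> = m + 1" "\<bar>m - 1\<bar> = m - 1" "\<bar>m\<bar> = m" by auto
    then show ?thesis using 2 unfolding tent_def by (auto simp: max_def)
  next
    case 3
    then have "\<bar>m + 1\<bar> = - m - 1" "\<bar>m - 1\<bar> = 1 - m" "\<bar>m\<bar> = - m" by auto
    then show ?thesis using 3 unfolding tent_def by (auto simp: max_def)
  qed
qed

text \<open>Discrete Leibniz rule. A second difference of one factor is nonzero only at its three
  kinks, where it is at most 2 and meets a factor of size at most 2N; the products of first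
  differences contribute the remaining 2.\<close>

lemma tent_product_second_difference:
  fixes N :: nat and h m :: int
  defines "g \<equiv> \<lambda>m. tent N m * tent N (m + h)"
  shows "\<bar>2 * g m - g (m - 1) - g (m + 1)\<bar> \<le>
     4 * int N * ((if m \<in> {0, 2 * int N, - 2 * int N} then 1 else 0)
        + (if m + h \<in> {0, 2 * int N, - 2 * int N} then 1 else 0)) + 2"
proof -
  define w v where "w = tent N m" and "v = tent N (m + h)"
  define d1 d2 e1 e2 where "d1 = tent N (m + 1) - tent N m" and "d2 = tent N (m - 1) - tent N m"
    and "e1 = tent N (m + h + 1) - tent N (m + h)" and "e2 = tent N (m + h - 1) - tent N (m + h)"
  define i1 i2 :: int where "i1 = (if m \<in> {0, 2 * int N, - 2 * int N} then 1 else 0)"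
    and "i2 = (if m + h \<in> {0, 2 * int N, - 2 * int N} then 1 else 0)"
  have "\<bar>d1 + d2\<bar> \<le> 2 * i1"
    using tent_second_difference[of N m] unfolding d1_def d2_def i1_def by (auto split: if_splits)
  moreover have "\<bar>e1 + e2\<bar> \<le> 2 * i2"
    using tent_second_difference[of N "m + h"] unfolding e1_def e2_def i2_def by (auto split: if_splits)
  moreover have wv: "\<bar>w\<bar> \<le> 2 * int N" "\<bar>v\<bar> \<le> 2 * int N"
    using tent_nonneg tent_le by (auto simp: w_def v_def)
  moreover have "0 \<le> i1" "0 \<le> i2" by (auto simp: i1_def i2_def)
  ultimately have "\<bar>(d1 + d2) * v\<bar> \<le> (2 * i1) * (2 * int N)" "\<bar>(e1 + e2) * w\<bar> \<le> (2 * i2) * (2 * int N)"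
    unfolding abs_mult by (intro mult_mono; simp)+
  moreover have "\<bar>d1 * e1\<bar> \<le> 1 * 1" "\<bar>d2 * e2\<bar> \<le> 1 * 1"
    unfolding abs_mult d1_def d2_def e1_def e2_def by (intro mult_mono tent_lipschitz; simp)+
  moreover have "2 * g m - g (m - 1) - g (m + 1) = - ((d1 + d2) * v + (e1 + e2) * w + d1 * e1 + d2 * e2)"
    unfolding g_def d1_def d2_def e1_def e2_def w_def v_def by (simp add: algebra_simps)
  moreover have "4 * int N * (i1 + i2) + 2 = (2 * i1) * (2 * int N) + (2 * i2) * (2 * int N) + 1 * 1 + 1 * 1"
    by (simp add: algebra_simps)
  ultimately show ?thesis
    unfolding i1_def[symmetric] i2_def[symmetric] by linarith
qed

text \<open>Two summations by parts at once: |1 - e(theta)|^2 = 2 - e(theta) - e(-theta), and each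
  exponential shifts the index by one. The window grows by one point on either side to catch the
  boundary terms.\<close>

lemma sum_second_difference_e2pi:
  fixes g :: "int \<Rightarrow> real" and K :: nat
  assumes "\<And>m. int K < \<bar>m\<bar> \<Longrightarrow> g m = 0"
  shows "norm (\<Sum>m\<in>{- int K..int K}. of_real (g m) * e2pi (of_int m * \<theta>)) * (norm (1 - e2pi \<theta>))\<^sup>2
    \<le> (\<Sum>m\<in>{- int K - 1..int K + 1}. \<bar>2 * g m - g (m - 1) - g (m + 1)\<bar>)"
proof -
  define z where "z m = e2pi (of_int m * \<theta>)" for m
  have z1: "z (m + 1) = z m * e2pi \<theta>" "z (m - 1) = z m * cnj (e2pi \<theta>)" for m
    by (simp_all add: z_def left_diff_distrib distrib_right e2pi_add e2pi_diff)
  let ?I = "{- int K - 1..int K + 1}"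
  have J: "(\<Sum>m\<in>?I. of_real (g m) * c m) = (\<Sum>m\<in>{- int K..int K}. of_real (g m) * c m)" for c :: "int \<Rightarrow> complex"
    using assms by (intro sum.mono_neutral_right) auto
  have zz: "e2pi \<theta> * cnj (e2pi \<theta>) = 1"
    using complex_norm_square[of "e2pi \<theta>"] by simp
  have "complex_of_real ((norm (1 - e2pi \<theta>))\<^sup>2) = 2 - e2pi \<theta> - cnj (e2pi \<theta>)"
    by (subst complex_norm_square) (simp add: algebra_simps zz)
  then have "(\<Sum>m\<in>{- int K..int K}. of_real (g m) * z m) * complex_of_real ((norm (1 - e2pi \<theta>))\<^sup>2)
      = (\<Sum>m\<in>{- int K..int K}. of_real (g m) * z m) * (2 - e2pi \<theta> - cnj (e2pi \<theta>))"
    by (simp only:)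
  also have "\<dots> = 2 * (\<Sum>m\<in>{- int K..int K}. of_real (g m) * z m) - (\<Sum>m\<in>{- int K..int K}. of_real (g m) * z (m + 1))
        - (\<Sum>m\<in>{- int K..int K}. of_real (g m) * z (m - 1))"
    by (simp only: z1 right_diff_distrib mult.assoc[symmetric] sum_distrib_right[symmetric] mult.commute[of _ "2 :: complex"])
  also have "(\<Sum>m\<in>{- int K..int K}. of_real (g m) * z (m + 1)) = (\<Sum>m\<in>{- int K + 1..int K + 1}. of_real (g (m - 1)) * z m)"
    by (rule sum.reindex_bij_witness[of _ "\<lambda>j. j - 1" "\<lambda>j. j + 1"]) auto
  also have "\<dots> = (\<Sum>m\<in>?I. of_real (g (m - 1)) * z m)"
    using assms by (intro sum.mono_neutral_left) auto
  also have "(\<Sum>m\<in>{- int K..int K}. of_real (g m) * z (m - 1)) = (\<Sum>m\<in>{- int K - 1..int K - 1}. of_real (g (m + 1)) * z m)"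
    by (rule sum.reindex_bij_witness[of _ "\<lambda>j. j + 1" "\<lambda>j. j - 1"]) auto
  also have "\<dots> = (\<Sum>m\<in>?I. of_real (g (m + 1)) * z m)"
    using assms by (intro sum.mono_neutral_left) auto
  also have "2 * (\<Sum>m\<in>{- int K..int K}. of_real (g m) * z m) - (\<Sum>m\<in>?I. of_real (g (m - 1)) * z m) - (\<Sum>m\<in>?I. of_real (g (m + 1)) * z m)
      = (\<Sum>m\<in>?I. of_real (2 * g m - g (m - 1) - g (m + 1)) * z m)"
    unfolding J[symmetric]
    by (simp only: of_real_diff of_real_mult of_real_numeral left_diff_distrib sum_subtractf sum_distrib_left mult.assoc)
  finally have eq: "(\<Sum>m\<in>{- int K..int K}. of_real (g m) * z m) * complex_of_real ((norm (1 - e2pi \<theta>))\<^sup>2)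
      = (\<Sum>m\<in>?I. of_real (2 * g m - g (m - 1) - g (m + 1)) * z m)" .
  have "norm (\<Sum>m\<in>{- int K..int K}. of_real (g m) * z m) * (norm (1 - e2pi \<theta>))\<^sup>2
      = norm (\<Sum>m\<in>?I. of_real (2 * g m - g (m - 1) - g (m + 1)) * z m)"
    unfolding eq[symmetric] norm_mult norm_of_real by simp
  also have "\<dots> \<le> (\<Sum>m\<in>?I. norm (of_real (2 * g m - g (m - 1) - g (m + 1)) * z m))"
    by (rule norm_sum)
  also have "\<dots> = (\<Sum>m\<in>?I. \<bar>2 * g m - g (m - 1) - g (m + 1)\<bar>)"
    unfolding norm_mult norm_of_real by (simp add: z_def)
  finally show ?thesis unfolding z_def .
qed

text \<open>The sum is at most 20 N^3 trivially and at most 38 N / |1 - e(theta)|^2 by second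
  differences. The product form states both at once, without a division, and 58 = 20 + 38.\<close>

lemma tent_correlation_bound:
  assumes "N \<ge> 1"
  shows "norm (\<Sum>m\<in>{- 2 * int N..2 * int N}. of_int (tent N m * tent N (m + h)) * e2pi (of_int m * \<theta>))
     * (1 + (real N)\<^sup>2 * (norm (1 - e2pi \<theta>))\<^sup>2) \<le> 58 * real N ^ 3"
proof -
  define g where "g m = real_of_int (tent N m * tent N (m + h))" for m
  define S where "S = norm (\<Sum>m\<in>{- int (2 * N)..int (2 * N)}. of_real (g m) * e2pi (of_int m * \<theta>))"
  have tr: "real_of_int (tent N m) \<le> 2 * real N" for m
    using tent_le[of N m] by (metis of_int_le_iff of_int_mult of_int_numeral of_int_of_nat_eq)
  have g: "\<bar>g m\<bar> \<le> 2 * real N * (2 * real N)" for m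
    unfolding g_def of_int_mult abs_mult using tent_nonneg[of N]
    by (intro mult_mono; simp add: tr)+
  have "S \<le> (\<Sum>m\<in>{- int (2 * N)..int (2 * N)}. 2 * real N * (2 * real N))"
    unfolding S_def by (rule sum_norm_le) (use g in \<open>auto simp: norm_mult\<close>)
  also have "\<dots> = (4 * real N + 1) * (4 * (real N)\<^sup>2)"
    by (simp add: power2_eq_square)
  also have "\<dots> \<le> (5 * real N) * (4 * (real N)\<^sup>2)"
    using assms by (intro mult_right_mono) auto
  finally have S1: "S \<le> 20 * real N ^ 3" by (simp add: power2_eq_square power3_eq_cube)
  let ?I = "{- int (2 * N) - 1..int (2 * N) + 1}"
  let ?Z = "{0, 2 * int N, - 2 * int N}"
  have "S * (norm (1 - e2pi \<theta>))\<^sup>2 \<le> (\<Sum>m\<in>?I. \<bar>2 * g m - g (m - 1) - g (m + 1)\<bar>)"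
    unfolding S_def by (rule sum_second_difference_e2pi) (auto simp: g_def tent_eq_0)
  also have "\<dots> \<le> (\<Sum>m\<in>?I. of_int (4 * int N * ((if m \<in> ?Z then 1 else 0) + (if m + h \<in> ?Z then 1 else 0)) + 2))"
  proof (rule sum_mono)
    fix m
    have "\<bar>2 * g m - g (m - 1) - g (m + 1)\<bar> = of_int \<bar>2 * (tent N m * tent N (m + h)) - tent N (m - 1) * tent N (m - 1 + h)
      - tent N (m + 1) * tent N (m + 1 + h)\<bar>" by (simp add: g_def)
    then show "\<bar>2 * g m - g (m - 1) - g (m + 1)\<bar> \<le> of_int (4 * int N * ((if m \<in> ?Z then 1 else 0) + (if m + h \<in> ?Z then 1 else 0)) + 2)"
      using tent_product_second_difference[of N m h] by (simp only: of_int_le_iff)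
  qed
  also have "\<dots> = real_of_int (4 * int N * ((\<Sum>m\<in>?I. if m \<in> ?Z then 1 else 0) + (\<Sum>m\<in>?I. if m + h \<in> ?Z then 1 else 0)) + (\<Sum>m\<in>?I. 2))"
    by (simp only: of_int_sum[symmetric] sum.distrib sum_distrib_left[symmetric])
  \<comment> \<open>Each factor has at most three kinks, and the constant 2 is summed over 4N + 3
    points, which gives at most 14N because N >= 1.\<close>
  also have "\<dots> \<le> real_of_int (4 * int N * (3 + 3) + 14 * int N)"
  proof -
    have c: "card ?Z \<le> 3" by (simp add: card_insert_if)
    have "(\<Sum>m\<in>?I. if m \<in> ?Z then 1 else 0 :: int) = int (card (?I \<inter> ?Z))"
      by (simp only: sum.If_cases finite_atLeastAtMost_int Collect_mem_eq) simp
    also have "\<dots> \<le> 3"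
      using c card_mono[of ?Z "?I \<inter> ?Z"] by simp
    finally have 1: "(\<Sum>m\<in>?I. if m \<in> ?Z then 1 else 0 :: int) \<le> 3" .
    have "(\<Sum>m\<in>?I. if m + h \<in> ?Z then 1 else 0 :: int) = int (card (?I \<inter> {m. m + h \<in> ?Z}))"
      by (subst sum.If_cases) auto
    also have "?I \<inter> {m. m + h \<in> ?Z} \<subseteq> (\<lambda>m. m - h) ` ?Z" by force
    then have "int (card (?I \<inter> {m. m + h \<in> ?Z})) \<le> 3"
      using c card_mono[of "(\<lambda>m. m - h) ` ?Z" "?I \<inter> {m. m + h \<in> ?Z}"] card_image_le[of ?Z "\<lambda>m. m - h"] by simp
    finally have 2: "(\<Sum>m\<in>?I. if m + h \<in> ?Z then 1 else 0 :: int) \<le> 3" .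
    have "(\<Sum>m\<in>?I. 2 :: int) \<le> 14 * int N" using assms by simp
    then show ?thesis using 1 2 unfolding of_int_le_iff by (intro add_mono mult_left_mono) auto
  qed
  also have "\<dots> = 38 * real N" by simp
  finally have "(real N)\<^sup>2 * (S * (norm (1 - e2pi \<theta>))\<^sup>2) \<le> (real N)\<^sup>2 * (38 * real N)"
    by (intro mult_left_mono) auto
  with S1 have "S * (1 + (real N)\<^sup>2 * (norm (1 - e2pi \<theta>))\<^sup>2) \<le> 58 * real N ^ 3"
    by (simp add: power2_eq_square power3_eq_cube algebra_simps)
  moreover have "S = norm (\<Sum>m\<in>{- 2 * int N..2 * int N}. of_int (tent N m * tent N (m + h)) * e2pi (of_int m * \<theta>))"
    unfolding S_def g_def by simp
  ultimately show ?thesis by simp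
qed

section \<open>Weyl's inequality near fractions with denominator of size X\<close>

lemma sum_inverse_square_le:
  fixes y :: real and R :: nat
  assumes "y > 0"
  shows "(\<Sum>\<rho>\<in>{- int R..int R}. 2 * y\<^sup>2 / (y + \<bar>of_int \<rho>\<bar>)\<^sup>2) \<le> 2 + 4 * y - 4 * y\<^sup>2 / (y + real R)"
\<comment> \<open>The subtracted term makes the bound inductive: equality holds at R = 0, and
  afterwards the two new summands are dominated by a telescoping difference.\<close>
proof (induction R)
  case 0
  then show ?case using assms by (simp add: power2_eq_square)
next
  case (Suc R)
  define z where "z = y + real R"
  have z: "z > 0" using assms by (simp add: z_def)
  have "{- int (Suc R)..int (Suc R)} = insert (- int (Suc R)) (insert (int (Suc R)) {- int R..int R})"
    by auto
  then have "(\<Sum>\<rho>\<in>{- int (Suc R)..int (Suc R)}. 2 * y\<^sup>2 / (y + \<bar>of_int \<rho>\<bar>)\<^sup>2)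
     = 4 * y\<^sup>2 / (z + 1)\<^sup>2 + (\<Sum>\<rho>\<in>{- int R..int R}. 2 * y\<^sup>2 / (y + \<bar>of_int \<rho>\<bar>)\<^sup>2)"
    by (simp add: z_def algebra_simps)
  also have "\<dots> \<le> 4 * y\<^sup>2 / (z + 1)\<^sup>2 + (2 + 4 * y - 4 * y\<^sup>2 / z)"
    using Suc unfolding z_def by simp
  also have "4 * y\<^sup>2 / (z + 1)\<^sup>2 \<le> 4 * y\<^sup>2 / z - 4 * y\<^sup>2 / (z + 1)"
  proof -
    have "1 / (z + 1)\<^sup>2 \<le> 1 / (z * (z + 1))"
      using z by (intro divide_left_mono) (auto simp: power2_eq_square)
    also have "\<dots> = 1 / z - 1 / (z + 1)" using z by (simp add: field_simps)
    finally have "4 * y\<^sup>2 * (1 / (z + 1)\<^sup>2) \<le> 4 * y\<^sup>2 * (1 / z - 1 / (z + 1))"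
      by (intro mult_left_mono) auto
    then show ?thesis by (simp add: right_diff_distrib)
  qed
  finally show ?case by (simp add: z_def algebra_simps)
qed

text \<open>Writing n = m + h cancels the quadratic phase in m and leaves the linear phase 2hmt. The
  variable x survives only in a unimodular factor depending on h, so the right side is uniform in
  x.\<close>

lemma weyl_differencing:
  fixes N :: nat and x t :: real
  defines "I \<equiv> {- 2 * int N..2 * int N}"
  shows "(norm (\<Sum>n\<in>I. of_int (tent N n) * e2pi (of_int n * x + of_int (n\<^sup>2) * t)))\<^sup>2
    \<le> (\<Sum>h\<in>{- 4 * int N..4 * int N}.
        norm (\<Sum>m\<in>I. of_int (tent N m * tent N (m + h)) * e2pi (of_int m * (of_int (2 * h) * t))))"
proof -
  define f where "f n = of_int (tent N n) * e2pi (of_int n * x + of_int (n\<^sup>2) * t)" for n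
  define H where "H = {- 4 * int N..4 * int N}"
  \<comment> \<open>For m in I the window m + H contains I, and the tent vanishes outside I; hence
    the range of h can be the same for all m.\<close>
  have shift: "(\<Sum>h\<in>H. f (m + h)) = (\<Sum>n\<in>I. f n)" if "m \<in> I" for m
  proof -
    have "(\<Sum>h\<in>H. f (m + h)) = (\<Sum>n\<in>{m - 4 * int N..m + 4 * int N}. f n)"
      by (rule sum.reindex_bij_witness[of _ "\<lambda>n. n - m" "\<lambda>h. m + h"]) (auto simp: H_def)
    also have "\<dots> = (\<Sum>n\<in>I. f n)"
      using that by (intro sum.mono_neutral_right) (auto simp: I_def f_def tent_def)
    finally show ?thesis .
  qed
  have "complex_of_real ((norm (\<Sum>n\<in>I. f n))\<^sup>2) = (\<Sum>n\<in>I. f n) * cnj (\<Sum>n\<in>I. f n)"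
    by (rule complex_norm_square)
  also have "\<dots> = (\<Sum>m\<in>I. (\<Sum>n\<in>I. f n) * cnj (f m))"
    by (simp add: sum_distrib_left)
  also have "\<dots> = (\<Sum>m\<in>I. (\<Sum>h\<in>H. f (m + h)) * cnj (f m))"
    by (intro sum.cong refl) (simp only: shift)
  also have "\<dots> = (\<Sum>m\<in>I. \<Sum>h\<in>H. f (m + h) * cnj (f m))"
    by (simp only: sum_distrib_right)
  also have "\<dots> = (\<Sum>h\<in>H. \<Sum>m\<in>I. f (m + h) * cnj (f m))"
    by (rule sum.swap)
  also have "\<dots> = (\<Sum>h\<in>H. e2pi (of_int h * x + of_int (h\<^sup>2) * t)
      * (\<Sum>m\<in>I. of_int (tent N m * tent N (m + h)) * e2pi (of_int m * (of_int (2 * h) * t))))"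
    unfolding sum_distrib_left
  proof (intro sum.cong refl)
    fix h m
    have "e2pi (of_int (m + h) * x + of_int ((m + h)\<^sup>2) * t) * cnj (e2pi (of_int m * x + of_int (m\<^sup>2) * t))
      = e2pi (of_int h * x + of_int (h\<^sup>2) * t) * e2pi (of_int m * (of_int (2 * h) * t))"
      unfolding e2pi_diff[symmetric] e2pi_add[symmetric]
      by (rule arg_cong[of _ _ e2pi]) (simp add: algebra_simps power2_eq_square)
    then show "f (m + h) * cnj (f m) = e2pi (of_int h * x + of_int (h\<^sup>2) * t) *
       (of_int (tent N m * tent N (m + h)) * e2pi (of_int m * (of_int (2 * h) * t)))"
      unfolding f_def by (simp add: mult_ac)
  qed
  finally have "norm (complex_of_real ((norm (\<Sum>n\<in>I. f n))\<^sup>2)) \<le> (\<Sum>h\<in>H. norm (e2pi (of_int h * x + of_int (h\<^sup>2) * t)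
      * (\<Sum>m\<in>I. of_int (tent N m * tent N (m + h)) * e2pi (of_int m * (of_int (2 * h) * t)))))"
    by (simp only: norm_sum)
  then show ?thesis
    unfolding norm_mult norm_e2pi norm_of_real f_def H_def by simp
qed

text \<open>On the arc, 2ht is close to rho(h)/q modulo 1, where rho(h) is the centred residue of
  2ha. The correlation for h is thus of order at most N^3 / (1 + (N rho(h)/q)^2). As the rho(h) are
  distinct, summing over h gives order N^3 * (q/N) = N^2 q, with no logarithm.\<close>

lemma weyl_sum_bound:
  fixes N X q :: nat and a :: int and x t :: real
  assumes N: "N \<ge> 1" and NX: "64 * N \<le> X" and q: "X < 4 * q" "q \<le> X"
    and cop: "coprime a (int q)" and t: "\<bar>t - of_int a / real q\<bar> \<le> 1 / (4 * (real X)\<^sup>2)"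
  shows "norm (\<Sum>n\<in>{- 2 * int N..2 * int N}. of_int (tent N n) * e2pi (of_int n * x + of_int (n\<^sup>2) * t))
    \<le> 18 * real N * sqrt (real X)"
proof -
  define H where "H = {- 4 * int N..4 * int N}"
  define B where "B h = norm (\<Sum>m\<in>{- 2 * int N..2 * int N}. of_int (tent N m * tent N (m + h))
      * e2pi (of_int m * (of_int (2 * h) * t)))" for h
  define y where "y = real q / real N"
  \<comment> \<open>The constant 64 serves this: two indices h, h' in H satisfy |2(h - h')| <= 16N <
    q, which makes \<open>\<rho>\<close> injective on H.\<close>
  have q0: "q > 0" and qN: "16 * N < q" using N NX q by linarith+
  have y: "y > 16" "y > 0" using qN N q0 by (auto simp: y_def field_simps)
  have "\<forall>h. \<exists>r. \<bar>2 * r\<bar> \<le> int q \<and> int q dvd 2 * h * a - r"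
    using symmetric_residue[of "int q"] q0 by (metis of_nat_0_less_iff)
  then obtain \<rho> where \<rho>: "\<And>h. \<bar>2 * \<rho> h\<bar> \<le> int q" "\<And>h. int q dvd 2 * h * a - \<rho> h"
    by metis
  have inj: "inj_on \<rho> H"
  proof (rule inj_onI)
    fix h h' assume h: "h \<in> H" "h' \<in> H" and eq: "\<rho> h = \<rho> h'"
    have "int q dvd (2 * h * a - \<rho> h) - (2 * h' * a - \<rho> h')"
      by (intro dvd_diff \<rho>(2))
    also have "\<dots> = (2 * (h - h')) * a" using eq by (simp add: algebra_simps)
    finally have d: "int q dvd 2 * (h - h')"
      using cop by (simp add: coprime_dvd_mult_left_iff coprime_commute)
    have "\<bar>2 * (h - h')\<bar> < int q" using h qN unfolding H_def by auto
    then have "2 * (h - h') = 0" using d dvd_imp_le_int[of "2 * (h - h')" "int q"] by linarith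
    then show "h = h'" by simp
  qed
  \<comment> \<open>At a/q itself the constant is 4. Moving from a/q to t changes the exponential by
    at most 1/(4q), hence by at most |rho(h)|/q when rho(h) is nonzero, and 3 remains.\<close>
  have lower: "3 * \<bar>of_int (\<rho> h)\<bar> / real q \<le> norm (1 - e2pi (of_int (2 * h) * t))" if h: "h \<in> H" for h
  proof (cases "\<rho> h = 0")
    case False
    obtain c where c: "2 * h * a - \<rho> h = int q * c" using \<rho>(2) by blast
    have "2 * h * a = int q * c + \<rho> h" using c by simp
    then have "real_of_int (2 * h * a) = real_of_int (int q * c + \<rho> h)" by (rule arg_cong)
    then have "of_int (2 * h) * (of_int a / real q) = of_int c + of_int (\<rho> h) / real q"
      using q0 by (simp add: field_simps)
    then have e: "e2pi (of_int (2 * h) * (of_int a / real q)) = e2pi (of_int (\<rho> h) / real q)"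
      by (simp add: e2pi_add)
    have "\<bar>real_of_int (\<rho> h) / real q\<bar> \<le> 1 / 2"
      using \<rho>(1)[of h] q0 by (simp add: field_simps)
    from norm_one_minus_e2pi_ge[OF this]
    have 1: "4 * \<bar>of_int (\<rho> h)\<bar> / real q \<le> norm (1 - e2pi (of_int (2 * h) * (of_int a / real q)))"
      unfolding e by simp
    have X0: "real X > 0" "real N \<le> real X / 64" using NX N by auto
    have "\<bar>of_int (2 * h) * t - of_int (2 * h) * (of_int a / real q)\<bar> = \<bar>real_of_int (2 * h)\<bar> * \<bar>t - of_int a / real q\<bar>"
      unfolding right_diff_distrib[symmetric] abs_mult ..
    also have "\<dots> \<le> (8 * real N) * (1 / (4 * (real X)\<^sup>2))"
      using h t by (intro mult_mono) (auto simp: H_def)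
    also have "\<dots> \<le> (8 * (real X / 64)) * (1 / (4 * (real X)\<^sup>2))"
      using X0 by (intro mult_right_mono) auto
    also have "\<dots> = 1 / (32 * real X)" using X0 by (simp add: power2_eq_square)
    also have "\<dots> \<le> 1 / (32 * real q)" using q q0 by (intro divide_left_mono) auto
    finally have "2 * pi * \<bar>of_int (2 * h) * t - of_int (2 * h) * (of_int a / real q)\<bar> \<le> 8 * (1 / (32 * real q))"
      using pi_less_4 by (intro mult_mono) auto
    then have 2: "norm (e2pi (of_int (2 * h) * t) - e2pi (of_int (2 * h) * (of_int a / real q))) \<le> 1 / (4 * real q)"
      using norm_e2pi_diff_le[of "of_int (2 * h) * t" "of_int (2 * h) * (of_int a / real q)"] by simp
    have "norm (1 - e2pi (of_int (2 * h) * (of_int a / real q))) \<le> norm (1 - e2pi (of_int (2 * h) * t))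
        + norm (e2pi (of_int (2 * h) * t) - e2pi (of_int (2 * h) * (of_int a / real q)))"
      using norm_triangle_ineq[of "1 - e2pi (of_int (2 * h) * t)"] by (metis add_diff_add add.commute diff_add_cancel diff_add_eq)
    with 1 2 have "4 * \<bar>of_int (\<rho> h)\<bar> / real q - 1 / (4 * real q) \<le> norm (1 - e2pi (of_int (2 * h) * t))"
      by linarith
    moreover have "1 / (4 * real q) \<le> \<bar>of_int (\<rho> h)\<bar> / real q"
      using False q0 by (simp add: field_simps)
    ultimately show ?thesis by linarith
  qed simp
  have Bh: "B h \<le> 58 * real N ^ 3 * (2 * y\<^sup>2 / (y + \<bar>of_int (\<rho> h)\<bar>)\<^sup>2)" if h: "h \<in> H" for h
  proof -
    define r where "r = \<bar>real_of_int (\<rho> h)\<bar>"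
    have r0: "r \<ge> 0" by (simp add: r_def)
    have B0: "B h \<ge> 0" by (simp add: B_def)
    have "r / y \<le> real N * (3 * r / real q)"
      using N q0 r0 by (simp add: y_def field_simps)
    also have "\<dots> \<le> real N * norm (1 - e2pi (of_int (2 * h) * t))"
      using lower[OF h] by (intro mult_left_mono) (auto simp: r_def)
    finally have "(r / y)\<^sup>2 \<le> (real N * norm (1 - e2pi (of_int (2 * h) * t)))\<^sup>2"
      using r0 y by (intro power_mono) auto
    then have "B h * (1 + (r / y)\<^sup>2) \<le> B h * (1 + (real N)\<^sup>2 * (norm (1 - e2pi (of_int (2 * h) * t)))\<^sup>2)"
      using B0 by (intro mult_left_mono) (auto simp: power_mult_distrib)
    also have "\<dots> \<le> 58 * real N ^ 3"
      unfolding B_def by (rule tent_correlation_bound[OF N])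
    finally have *: "B h * (1 + (r / y)\<^sup>2) \<le> 58 * real N ^ 3" .
    \<comment> \<open>This replaces 1 / (1 + (r/y)^2) by 2y^2 / (y + r)^2, the shape that telescopes
      in \<open>sum_inverse_square_le\<close>.\<close>
    have "(y + r)\<^sup>2 + (y - r)\<^sup>2 = 2 * y\<^sup>2 * (1 + (r / y)\<^sup>2)"
      using y by (simp add: field_simps power2_eq_square)
    then have "(y + r)\<^sup>2 \<le> 2 * y\<^sup>2 * (1 + (r / y)\<^sup>2)"
      by (metis le_add_same_cancel1 zero_le_power2)
    then have "B h * (y + r)\<^sup>2 \<le> B h * (2 * y\<^sup>2 * (1 + (r / y)\<^sup>2))"
      using B0 by (intro mult_left_mono)
    also have "\<dots> = 2 * y\<^sup>2 * (B h * (1 + (r / y)\<^sup>2))" by (simp add: mult_ac)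
    also have "\<dots> \<le> 2 * y\<^sup>2 * (58 * real N ^ 3)"
      using * by (intro mult_left_mono) auto
    finally show ?thesis
      using y r0 unfolding r_def[symmetric] by (simp add: pos_le_divide_eq mult_ac)
  qed
  have "(\<Sum>h\<in>H. 2 * y\<^sup>2 / (y + \<bar>of_int (\<rho> h)\<bar>)\<^sup>2) = (\<Sum>r\<in>\<rho> ` H. 2 * y\<^sup>2 / (y + \<bar>of_int r\<bar>)\<^sup>2)"
    by (simp add: sum.reindex[OF inj])
  also have "\<dots> \<le> (\<Sum>r\<in>{- int q..int q}. 2 * y\<^sup>2 / (y + \<bar>of_int r\<bar>)\<^sup>2)"
  proof (rule sum_mono2)
    show "\<rho> ` H \<subseteq> {- int q..int q}"
    proof
      fix r assume "r \<in> \<rho> ` H"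
      then have "\<bar>2 * r\<bar> \<le> int q" using \<rho>(1) by auto
      then show "r \<in> {- int q..int q}" by auto
    qed
  qed auto
  also have "\<dots> \<le> 2 + 4 * y - 4 * y\<^sup>2 / (y + real q)"
    using y by (intro sum_inverse_square_le)
  also have "\<dots> \<le> 5 * y"
  proof -
    have "0 \<le> 4 * y\<^sup>2 / (y + real q)" using y by simp
    then show ?thesis using y by linarith
  qed
  finally have sumle: "(\<Sum>h\<in>H. 2 * y\<^sup>2 / (y + \<bar>of_int (\<rho> h)\<bar>)\<^sup>2) \<le> 5 * y" .
  let ?S = "norm (\<Sum>n\<in>{- 2 * int N..2 * int N}. of_int (tent N n) * e2pi (of_int n * x + of_int (n\<^sup>2) * t))"
  have "?S\<^sup>2 \<le> (\<Sum>h\<in>H. B h)"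
    unfolding B_def H_def by (rule weyl_differencing)
  also have "\<dots> \<le> (\<Sum>h\<in>H. 58 * real N ^ 3 * (2 * y\<^sup>2 / (y + \<bar>of_int (\<rho> h)\<bar>)\<^sup>2))"
    by (intro sum_mono Bh)
  also have "\<dots> = 58 * real N ^ 3 * (\<Sum>h\<in>H. 2 * y\<^sup>2 / (y + \<bar>of_int (\<rho> h)\<bar>)\<^sup>2)"
    by (rule sum_distrib_left[symmetric])
  also have "\<dots> \<le> 58 * real N ^ 3 * (5 * y)"
    using sumle by (intro mult_left_mono) auto
  also have "\<dots> = 290 * (real N)\<^sup>2 * real q"
    using N by (simp add: y_def power2_eq_square power3_eq_cube)
  \<comment> \<open>290 = 58 * 5 is rounded up to the square of 18.\<close>
  also have "\<dots> \<le> 324 * (real N)\<^sup>2 * real X"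
    using q by (intro mult_mono) auto
  also have "\<dots> = (18 * real N * sqrt (real X))\<^sup>2"
    by (simp add: power_mult_distrib)
  finally show ?thesis
    by (rule power2_le_imp_le) simp
qed

section \<open>Ramanujan sums and the divisor bound\<close>

lemma prod_primes_dvd_iff:
  fixes n :: nat
  assumes "finite A" "\<And>p. p \<in> A \<Longrightarrow> prime p"
  shows "\<Prod>A dvd n \<longleftrightarrow> (\<forall>p\<in>A. p dvd n)"
  using assms
proof (induction A rule: finite_induct)
  case (insert p A)
  have "coprime p (\<Prod>A)"
    using insert by (intro prod_coprime_right) (metis insert_iff primes_coprime)
  then have "p * \<Prod>A dvd n \<longleftrightarrow> p dvd n \<and> \<Prod>A dvd n"
    by (metis divides_mult dvd_mult_left dvd_mult_right)
  then show ?case using insert by simp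
qed simp

text \<open>A is recovered from its product as the set of members of P dividing it. Subsets of P can
  therefore index squarefree divisors.\<close>

lemma inj_on_prod_primes:
  assumes "finite (P :: nat set)" "\<And>p. p \<in> P \<Longrightarrow> prime p"
  shows "inj_on (\<lambda>A. \<Prod>A) (Pow P)"
proof -
  have "A = {p \<in> P. p dvd \<Prod>A}" if "A \<subseteq> P" for A
  proof -
    have fin: "finite A" using that assms(1) by (rule finite_subset)
    have "p \<in> A" if "p \<in> P" "p dvd \<Prod>A" for p
      using that assms(2) fin \<open>A \<subseteq> P\<close> prime_dvd_prod_iff[OF fin, of p "\<lambda>x. x"]
      by (metis primes_dvd_imp_eq subsetD)
    moreover have "p dvd \<Prod>A" if "p \<in> A" for p
      using that fin by (rule dvd_prodI[rotated, of p A "\<lambda>x. x", simplified])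
    ultimately show ?thesis using that by blast
  qed
  then show ?thesis by (intro inj_onI) (metis Pow_iff)
qed

lemma sum_e2pi_nat_complete:
  fixes k :: int
  assumes "m > 0"
  shows "(\<Sum>b\<in>{0<..m}. e2pi (of_int k * real b / real m)) = (if int m dvd k then of_nat m else 0)"
proof -
  have "(\<Sum>b\<in>{0<..m}. e2pi (of_int k * real b / real m))
      = (\<Sum>j\<in>{1..<1 + int m}. e2pi (of_int (k * j) / of_int (int m)))"
    by (rule sum.reindex_bij_witness[of _ nat int]) auto
  also have "\<dots> = (if int m dvd k then of_int (int m) else 0)"
    using assms by (intro sum_e2pi_complete) auto
  finally show ?thesis by simp
qed

text \<open>Inclusion--exclusion over the prime factors of \<open>q\<close> stands in for the Moebius function.\<close>

lemma norm_ramanujan_sum_le: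
  fixes k :: int
  assumes "q > 0"
  shows "norm (\<Sum>a\<in>totatives q. e2pi (of_int k * real a / real q))
    \<le> real (\<Sum>d | d dvd q \<and> int d dvd k. d)"
proof -
  define P where "P = prime_factors q"
  define f where "f a = e2pi (of_int k * real a / real q)" for a
  define ind where "ind A a = (if \<Prod>A dvd a then 1 else 0 :: complex)" for A and a :: nat
  have P: "finite P" "\<And>p. p \<in> P \<Longrightarrow> prime p" "\<And>p. p \<in> P \<Longrightarrow> p dvd q"
    by (auto simp: P_def)
  have prodP: "\<Prod>A dvd q" if "A \<subseteq> P" for A
    using that P finite_subset[OF that] by (subst prod_primes_dvd_iff) blast+
  \<comment> \<open>Expansion of the product of 1 - [p dvd a] over the primes p dividing q.\<close>
  have coprime_ind: "(if coprime a q then 1 else 0) = (\<Sum>A\<in>Pow P. (- 1) ^ card A * ind A a)"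
    if "a > 0" for a
  proof -
    have "coprime a q \<longleftrightarrow> (\<forall>p\<in>P. \<not> p dvd a)"
    proof
      assume "coprime a q"
      then show "\<forall>p\<in>P. \<not> p dvd a" using P by (metis coprime_common_divisor not_prime_unit)
    next
      assume *: "\<forall>p\<in>P. \<not> p dvd a"
      show "coprime a q"
      proof (rule ccontr)
        assume "\<not> coprime a q"
        then obtain p where "prime p" "p dvd a" "p dvd q"
          by (metis coprime_iff_gcd_eq_1 gcd_dvd1 gcd_dvd2 dvd_trans prime_factor_nat)
        then show False using * assms by (auto simp: P_def prime_factors_dvd)
      qed
    qed
    then have "(if coprime a q then 1 else 0) = (\<Prod>p\<in>P. - (if p dvd a then 1 else 0) + (1 :: complex))"
      using P(1) by (auto simp: prod_zero_iff)
    also have "\<dots> = (\<Sum>A\<in>Pow P. (\<Prod>p\<in>A. - (if p dvd a then 1 else 0)) * (\<Prod>p\<in>P - A. 1))"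
      by (rule prod_add[OF P(1)])
    also have "\<dots> = (\<Sum>A\<in>Pow P. (- 1) ^ card A * ind A a)"
    proof (intro sum.cong refl)
      fix A assume A: "A \<in> Pow P"
      then have fin: "finite A" using P(1) finite_subset by auto
      have "(\<Prod>p\<in>A. (if p dvd a then 1 else 0 :: complex)) = (if \<forall>p\<in>A. p dvd a then 1 else 0)"
        using fin by (auto simp: prod_zero_iff)
      also have "\<dots> = ind A a"
        using prod_primes_dvd_iff[OF fin, of a] A P(2) by (auto simp: ind_def)
      finally show "(\<Prod>p\<in>A. - (if p dvd a then 1 else 0)) * (\<Prod>p\<in>P - A. 1) = (- 1) ^ card A * ind A a"
        by (simp add: prod_uminus)
    qed
    finally show ?thesis .
  qed
  \<comment> \<open>Substituting a = D b turns the sum over multiples of D into a complete sum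
    modulo q/D.\<close>
  have inner: "(\<Sum>a\<in>{0<..q}. ind A a * f a) = (if int (q div \<Prod>A) dvd k then of_nat (q div \<Prod>A) else 0)"
    if A: "A \<subseteq> P" for A
  proof -
    define D where "D = \<Prod>A"
    obtain m where m: "q = D * m" using prodP[OF A] by (auto simp: D_def)
    have m0: "m > 0" "D > 0" using m assms by auto
    have "(\<Sum>a\<in>{0<..q}. ind A a * f a) = (\<Sum>a\<in>{a\<in>{0<..q}. D dvd a}. f a)"
      by (subst sum.inter_filter) (auto simp: ind_def D_def intro!: sum.cong)
    also have "\<dots> = (\<Sum>b\<in>{0<..m}. e2pi (of_int k * real b / real m))"
      using m m0
      by (intro sum.reindex_bij_witness[of _ "\<lambda>b. D * b" "\<lambda>a. a div D"]) (auto simp: f_def)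
    also have "\<dots> = (if int m dvd k then of_nat m else 0)"
      by (rule sum_e2pi_nat_complete[OF m0(1)])
    finally show ?thesis using m m0 by (simp add: D_def[symmetric])
  qed
  have "(\<Sum>a\<in>totatives q. f a) = (\<Sum>a\<in>{0<..q}. (if coprime a q then 1 else 0) * f a)"
    unfolding totatives_def by (subst sum.inter_filter) (auto intro!: sum.cong)
  also have "\<dots> = (\<Sum>a\<in>{0<..q}. \<Sum>A\<in>Pow P. (- 1) ^ card A * (ind A a * f a))"
    by (intro sum.cong refl) (simp add: coprime_ind sum_distrib_right mult.assoc)
  also have "\<dots> = (\<Sum>A\<in>Pow P. (- 1) ^ card A * (\<Sum>a\<in>{0<..q}. ind A a * f a))"
    by (subst sum.swap) (simp add: sum_distrib_left)
  finally have "norm (\<Sum>a\<in>totatives q. f a) \<le> (\<Sum>A\<in>Pow P. norm ((- 1) ^ card A * (\<Sum>a\<in>{0<..q}. ind A a * f a)))"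
    by (simp only: norm_sum)
  also have "\<dots> = (\<Sum>A\<in>Pow P. if int (q div \<Prod>A) dvd k then real (q div \<Prod>A) else 0)"
    by (intro sum.cong refl) (auto simp: norm_mult norm_power inner)
  also have "\<dots> = (\<Sum>d\<in>(\<lambda>A. q div \<Prod>A) ` Pow P. if int d dvd k then real d else 0)"
  proof -
    \<comment> \<open>Different sets A give different divisors q/D, so each divisor is counted at
      most once and the sum can be enlarged to all divisors of q.\<close>
    have "inj_on (\<lambda>A. q div \<Prod>A) (Pow P)"
    proof (rule inj_onI)
      fix A B assume AB: "A \<in> Pow P" "B \<in> Pow P" "q div \<Prod>A = q div \<Prod>B"
      then have "\<Prod>A * (q div \<Prod>A) = \<Prod>B * (q div \<Prod>A)"
        using prodP[of A] prodP[of B] by (metis Pow_iff dvd_mult_div_cancel)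
      moreover have "q div \<Prod>A \<noteq> 0"
        using prodP[of A] AB assms by (metis Pow_iff dvd_mult_div_cancel mult_0_right neq0_conv)
      ultimately have "\<Prod>A = \<Prod>B" by simp
      then show "A = B" using inj_on_prod_primes[OF P(1,2)] AB by (metis inj_onD)
    qed
    then show ?thesis by (simp add: sum.reindex)
  qed
  also have "\<dots> \<le> (\<Sum>d | d dvd q. if int d dvd k then real d else 0)"
  proof (rule sum_mono2)
    have "q div \<Prod>A dvd q" if "A \<subseteq> P" for A
      by (rule dvdI[of _ _ "\<Prod>A"]) (simp add: prodP[OF that])
    then show "(\<lambda>A. q div \<Prod>A) ` Pow P \<subseteq> {d. d dvd q}" by auto
  qed (use assms in auto)
  also have "\<dots> = real (\<Sum>d | d dvd q \<and> int d dvd k. d)"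
    using sum.inter_filter[of "{d. d dvd q}" real "\<lambda>d. int d dvd k"] assms by simp
  finally show ?thesis unfolding f_def .
qed

section \<open>Totients of the admissible denominators\<close>

lemma mult_card_multiples_le:
  assumes "q > 0"
  shows "q * card {n\<in>{1..X}. q dvd n} \<le> X"
proof -
  have "{n\<in>{1..X}. q dvd n} \<subseteq> (\<lambda>k. q * k) ` {1..X div q}"
    using assms by (force elim!: dvdE simp: less_eq_div_iff_mult_less_eq mult.commute)
  then have "card {n\<in>{1..X}. q dvd n} \<le> card {1..X div q}"
    by (meson card_image_le card_mono finite_atLeastAtMost finite_imageI le_trans)
  then have "q * card {n\<in>{1..X}. q dvd n} \<le> q * (X div q)" by simp
  also have "\<dots> \<le> X" by simp
  finally show ?thesis .
qed

text \<open>The upper end keeps the Weyl bound at N sqrt X. The lower end keeps q above 16N while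
  discarding only part of the total mass of the totients.\<close>

definition denominators :: "nat \<Rightarrow> nat set" where
  "denominators X = {q. X < 4 * q \<and> q \<le> X}"

lemma finite_denominators [simp]: "finite (denominators X)"
  unfolding denominators_def by (rule finite_subset[of _ "{..X}"]) auto

text \<open>Sum the identity n = (sum of totient q over q dvd n) over n <= X and count by q.
  Denominators up to X/4 contribute at most X each, so at most X^2/4; the others have at most three
  multiples up to X. With S the sum on the right, X^2/2 <= X^2/4 + 3 S.\<close>

lemma sum_totient_denominators_ge:
  "X\<^sup>2 \<le> 12 * (\<Sum>q\<in>denominators X. totient q)"
proof -
  define S where "S = (\<Sum>q\<in>denominators X. totient q)"
  define c where "c q = card {n\<in>{1..X}. q dvd n}" for q
  have "(\<Sum>n\<in>{1..X}. n) = (\<Sum>n\<in>{1..X}. \<Sum>q | q dvd n. totient q)"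
    by (simp only: totient_divisor_sum)
  also have "\<dots> = (\<Sum>n\<in>{1..X}. \<Sum>q\<in>{1..X}. if q dvd n then totient q else 0)"
  proof (rule sum.cong[OF refl])
    fix n assume n: "n \<in> {1..X}"
    have "{q. q dvd n} = {q\<in>{1..X}. q dvd n}"
      using n by (auto dest: dvd_imp_le intro: Suc_leI dvd_pos_nat)
    then show "(\<Sum>q | q dvd n. totient q) = (\<Sum>q\<in>{1..X}. if q dvd n then totient q else 0)"
      by (simp only: sum.inter_filter[OF finite_atLeastAtMost])
  qed
  also have "\<dots> = (\<Sum>q\<in>{1..X}. \<Sum>n\<in>{1..X}. if q dvd n then totient q else 0)"
    by (rule sum.swap)
  also have "\<dots> = (\<Sum>q\<in>{1..X}. totient q * c q)"
    unfolding c_def by (simp add: sum.inter_filter[symmetric] mult.commute)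
  also have "\<dots> \<le> (\<Sum>q\<in>{1..X}. (if q \<le> X div 4 then X else 0) + (if q \<in> denominators X then 3 * totient q else 0))"
  proof (rule sum_mono)
    fix q assume q: "q \<in> {1..X}"
    have qc: "q * c q \<le> X" unfolding c_def using q by (intro mult_card_multiples_le) auto
    show "totient q * c q \<le> (if q \<le> X div 4 then X else 0) + (if q \<in> denominators X then 3 * totient q else 0)"
    proof (cases "q \<le> X div 4")
      case True
      have "totient q * c q \<le> q * c q" by (rule mult_right_mono[OF totient_le]) simp
      then have "totient q * c q \<le> X" using qc by (rule order_trans)
      then show ?thesis using True by (simp add: trans_le_add1)
    next
      case False
      then have D: "X < 4 * q" by linarith
      have "c q < 4"
      proof (rule ccontr)
        assume "\<not> c q < 4"
        then have "q * 4 \<le> q * c q" by (intro mult_left_mono) auto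
        then show False using qc D by linarith
      qed
      then have "totient q * c q \<le> totient q * 3" by (intro mult_left_mono) auto
      then show ?thesis using D False q by (simp add: denominators_def)
    qed
  qed
  also have "\<dots> = (X div 4) * X + 3 * S"
  proof -
    have "{q\<in>{1..X}. q \<le> X div 4} = {1..X div 4}" by auto
    then have "(\<Sum>q\<in>{1..X}. if q \<le> X div 4 then X else 0) = (X div 4) * X"
      by (simp add: sum.inter_filter[symmetric])
    moreover have "{q\<in>{1..X}. q \<in> denominators X} = denominators X"
      by (auto simp: denominators_def)
    then have "(\<Sum>q\<in>{1..X}. if q \<in> denominators X then 3 * totient q else 0) = 3 * S"
      by (simp add: sum.inter_filter[symmetric] S_def sum_distrib_left)
    ultimately show ?thesis by (simp only: sum.distrib)
  qed
  finally have "2 * (\<Sum>n\<in>{1..X}. n) \<le> 2 * ((X div 4) * X) + 6 * S" by simp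
  moreover have "2 * (\<Sum>n\<in>{1..X}. n) = X * (X + 1)"
    using double_gauss_sum_from_Suc_0[of X, where 'a = nat] by simp
  moreover have "4 * ((X div 4) * X) \<le> X * X"
    by (metis mult.assoc mult_le_mono1 times_div_less_eq_dividend)
  ultimately have "X * X \<le> 12 * S" unfolding distrib_left mult_1_right by linarith
  then show ?thesis by (simp add: S_def power2_eq_square)
qed

section \<open>The divisor bound\<close>

lemma card_divisors_prime_power_mult_le:
  fixes p :: nat
  assumes "prime p" "m > 0"
  shows "card {d. d dvd p ^ a * m} \<le> (a + 1) * card {d. d dvd m}"
proof -
  have "{d. d dvd p ^ a * m} \<subseteq> (\<lambda>(i, e). p ^ i * e) ` ({..a} \<times> {d. d dvd m})"
  proof
    fix d assume "d \<in> {d. d dvd p ^ a * m}"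
    then obtain b c where bc: "d = b * c" "b dvd p ^ a" "c dvd m"
      using division_decomp by blast
    then obtain i where "i \<le> a" "b = p ^ i" using divides_primepow_nat[OF assms(1)] by blast
    then show "d \<in> (\<lambda>(i, e). p ^ i * e) ` ({..a} \<times> {d. d dvd m})" using bc by force
  qed
  moreover have fin: "finite ({..a} \<times> {d. d dvd m})" using assms by simp
  ultimately have "card {d. d dvd p ^ a * m} \<le> card ((\<lambda>(i, e). p ^ i * e) ` ({..a} \<times> {d. d dvd m}))"
    by (intro card_mono finite_imageI)
  also have "\<dots> \<le> card ({..a} \<times> {d. d dvd m})" using fin by (rule card_image_le)
  finally show ?thesis by (simp add: card_cartesian_product)
qed

text \<open>A prime power p^a in n contributes the ratio (a + 1) / p^(a delta). It is at most 1 once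
  p^delta >= 2 and at most a constant for the finitely many smaller primes.\<close>

lemma divisor_count_bound:
  fixes \<delta> :: real
  assumes "\<delta> > 0"
  shows "\<exists>C > 0. \<forall>n \<ge> 1. real (card {d. d dvd n}) \<le> C * real n powr \<delta>"
proof -
  \<comment> \<open>Beyond \<open>P0\<close> every prime satisfies p^delta >= 2, and then a + 1 <=
    2^a suffices.\<close>
  define P0 :: nat where "P0 = nat \<lceil>2 powr (1 / \<delta>)\<rceil>"
  \<comment> \<open>Both C0 >= 1 and C0 * delta * ln 2 >= 1 are needed to pass from a + 1 to C0 * (1
    + a delta ln 2) and then to C0 * 2^(a delta).\<close>
  define C0 :: real where "C0 = max 1 (1 / (\<delta> * ln 2))"
  have C0: "C0 \<ge> 1" "C0 * (\<delta> * ln 2) \<ge> 1"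
  proof -
    have "1 / (\<delta> * ln 2) * (\<delta> * ln 2) \<le> C0 * (\<delta> * ln 2)"
      using assms by (intro mult_right_mono) (auto simp: C0_def)
    then show "C0 * (\<delta> * ln 2) \<ge> 1" using assms by simp
  qed (simp add: C0_def)
  have small: "real (a + 1) \<le> C0 * (real p ^ a) powr \<delta>" if "prime p" for p a :: nat
  proof -
    have p: "p \<ge> 2" using that by (rule prime_ge_2_nat)
    have "real (a + 1) \<le> C0 + C0 * (\<delta> * ln 2) * real a"
      using C0 mult_right_mono[OF C0(2), of "real a"] by simp
    also have "\<dots> = C0 * (1 + real a * \<delta> * ln 2)" by (simp add: algebra_simps)
    also have "\<dots> \<le> C0 * exp (real a * \<delta> * ln 2)"
      using C0 by (intro mult_left_mono exp_ge_add_one_self) auto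
    also have "exp (real a * \<delta> * ln 2) = (2 ^ a) powr \<delta>"
      by (simp add: powr_def ln_realpow)
    also have "C0 * (2 ^ a) powr \<delta> \<le> C0 * (real p ^ a) powr \<delta>"
      using p assms C0 by (intro mult_left_mono powr_mono2 power_mono) auto
    finally show ?thesis .
  qed
  have large: "real (a + 1) \<le> (real p ^ a) powr \<delta>" if "p > P0" for p a :: nat
  proof -
    have "2 powr (1 / \<delta>) \<le> real P0" unfolding P0_def by linarith
    then have "2 powr (1 / \<delta>) \<le> real p" using that by linarith
    then have "(2 powr (1 / \<delta>)) powr \<delta> \<le> real p powr \<delta>"
      using assms by (intro powr_mono2) auto
    then have "2 \<le> real p powr \<delta>" using assms by (simp add: powr_powr)
    then have "2 ^ a \<le> (real p powr \<delta>) ^ a" by (intro power_mono) auto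
    also have "\<dots> = (real p ^ a) powr \<delta>"
    proof -
      have "(real p ^ a) powr \<delta> = (real p powr real a) powr \<delta>"
        using that by (simp add: powr_realpow)
      also have "\<dots> = real p powr (\<delta> * real a)"
        unfolding powr_powr by (simp only: mult.commute)
      also have "\<dots> = (real p powr \<delta>) powr real a" by (simp only: powr_powr)
      also have "\<dots> = (real p powr \<delta>) ^ a" using that by (intro powr_realpow) auto
      finally show ?thesis ..
    qed
    finally have "2 ^ a \<le> (real p ^ a) powr \<delta>" .
    moreover have "real (a + 1) \<le> real (2 ^ a)"
      using less_exp[of a] by (simp only: of_nat_le_iff)
    ultimately show ?thesis by simp
  qed
  \<comment> \<open>The induction records how many small primes divide n; only afterwards is that
    number replaced by the size P0 + 1 of \<open>{..P0}\<close>.\<close>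
  define g where "g n = C0 ^ card (prime_factors n \<inter> {..P0})" for n :: nat
  have main: "real (card {d. d dvd n}) \<le> g n * real n powr \<delta>" if "n \<ge> 1" for n
    using that
  proof (induction n rule: less_induct)
    case (less n)
    show ?case
    proof (cases "n = 1")
      case True
      then show ?thesis by (simp add: g_def)
    next
      case False
      then obtain p where p: "prime p" "p dvd n" using prime_factor_nat by blast
      have "n \<noteq> 0" "\<not> is_unit p" using less.prems p(1) by auto
      then obtain m where m: "n = p ^ multiplicity p n * m" "\<not> p dvd m"
        using multiplicity_decompose'[of n p] by blast
      define a where "a = multiplicity p n"
      have n: "n = p ^ a * m" unfolding a_def by (rule m(1))
      have m0: "m \<ge> 1" using less.prems n by (cases m) auto
      have a: "a > 0"
      proof (rule ccontr)
        assume "\<not> a > 0"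
        then have "n = m" using n by simp
        then show False using p(2) m(2) by simp
      qed
      have "1 < p ^ a" using a p(1) by (meson one_less_power prime_gt_1_nat)
      then have mn: "m < n" using n m0 by simp
      have pf: "prime_factors n = insert p (prime_factors m)"
        using n m0 a p(1) by (simp add: prime_factors_product prime_factors_power prime_prime_factors)
      have pm: "p \<notin> prime_factors m" using m(2) by auto
      have "real (a + 1) * g m \<le> (real p ^ a) powr \<delta> * g n"
      proof (cases "p \<le> P0")
        case True
        then have "prime_factors n \<inter> {..P0} = insert p (prime_factors m \<inter> {..P0})" using pf by auto
        then have "g n = C0 * g m" using pm by (simp add: g_def)
        moreover have "g m \<ge> 0" using C0 by (simp add: g_def)
        ultimately show ?thesis
          using mult_right_mono[OF small[OF p(1), of a], of "g m"] by (simp add: mult_ac)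
      next
        case False
        then have "prime_factors n \<inter> {..P0} = prime_factors m \<inter> {..P0}" using pf by auto
        then have "g n = g m" by (simp add: g_def)
        moreover have "g m \<ge> 0" using C0 by (simp add: g_def)
        ultimately show ?thesis
          using False large[of p a] by (simp add: mult_right_mono)
      qed
      then have *: "real (a + 1) * g m * real m powr \<delta> \<le> (real p ^ a) powr \<delta> * g n * real m powr \<delta>"
        by (intro mult_right_mono) auto
      have "real (card {d. d dvd n}) \<le> real (a + 1) * real (card {d. d dvd m})"
        using card_divisors_prime_power_mult_le[OF p(1), of m a] m0 unfolding n of_nat_mult[symmetric] of_nat_le_iff by simp
      also have "\<dots> \<le> real (a + 1) * (g m * real m powr \<delta>)"
        using less.IH[OF mn m0] by (intro mult_left_mono) auto
      also have "\<dots> \<le> g n * ((real p ^ a) powr \<delta> * real m powr \<delta>)"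
        using * by (simp add: mult_ac)
      also have "\<dots> = g n * real n powr \<delta>"
        by (simp add: n powr_mult)
      finally show ?thesis .
    qed
  qed
  have "real (card {d. d dvd n}) \<le> C0 ^ (P0 + 1) * real n powr \<delta>" if "n \<ge> 1" for n
  proof -
    have "card (prime_factors n \<inter> {..P0}) \<le> card {..P0}" by (intro card_mono) auto
    then have "g n \<le> C0 ^ (P0 + 1)" unfolding g_def using C0 by (intro power_increasing) auto
    then have "g n * real n powr \<delta> \<le> C0 ^ (P0 + 1) * real n powr \<delta>" by (intro mult_right_mono) auto
    then show ?thesis using main[OF that] by linarith
  qed
  moreover have "C0 ^ (P0 + 1) > 0" using C0 by (intro zero_less_power) auto
  ultimately show ?thesis by blast
qed

section \<open>Arcs around reduced fractions\<close>

definition arc_index :: "nat \<Rightarrow> nat \<Rightarrow> ((nat \<times> nat) \<times> int) set" where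
  "arc_index X J = (SIGMA q:denominators X. totatives q) \<times> {- int J..int J}"

text \<open>The point a/q + j/M in units of 1/M, exact when q divides M. With M = 4 X^2 J the range
  |j| <= J is an arc of radius 1/(4X^2). Points matter only modulo M.\<close>

definition arc_point :: "nat \<Rightarrow> (nat \<times> nat) \<times> int \<Rightarrow> int" where
  "arc_point M i = (case i of ((q, a), j) \<Rightarrow> int (a * (M div q)) + j)"

lemma finite_arc_index [simp]: "finite (arc_index X J)"
  by (simp add: arc_index_def)

text \<open>Distinct reduced fractions with denominators at most X are at least 1/X^2 apart modulo
  1, whereas two offsets j/M differ by at most 1/(2X^2).\<close>

lemma arc_point_inj:
  assumes M: "M = 4 * X\<^sup>2 * J" "J \<ge> 1" "\<And>q. 1 \<le> q \<Longrightarrow> q \<le> X \<Longrightarrow> q dvd M"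
    and i: "i \<in> arc_index X J" "i' \<in> arc_index X J"
    and dvd: "int M dvd arc_point M i - arc_point M i'"
  shows "i = i'"
proof -
  obtain q a j where i_eq: "i = ((q, a), j)" by (metis prod.exhaust)
  obtain q' a' j' where i'_eq: "i' = ((q', a'), j')" by (metis prod.exhaust)
  have q: "X < 4 * q" "q \<le> X" and a: "coprime a q" "0 < a" "a \<le> q" and j: "\<bar>j\<bar> \<le> int J"
    using i by (auto simp: i_eq arc_index_def denominators_def totatives_def)
  have q': "X < 4 * q'" "q' \<le> X" and a': "coprime a' q'" "0 < a'" "a' \<le> q'" and j': "\<bar>j'\<bar> \<le> int J"
    using i by (auto simp: i'_eq arc_index_def denominators_def totatives_def)
  have pos: "0 < q" "0 < q'" using q q' by auto
  then have "q dvd M" "q' dvd M" using M(3) q(2) q'(2) by simp_all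
  then obtain u u' where u: "M = q * u" "M = q' * u'" unfolding dvd_def by blast
  have u0: "M div q = u" using pos unfolding u(1) by simp
  have u0': "M div q' = u'" using pos unfolding u(2) by simp
  obtain c where "arc_point M i - arc_point M i' = int M * c" using dvd by auto
  then have c: "int a * int u + j - (int a' * int u' + j') = int M * c"
    by (simp add: i_eq i'_eq arc_point_def u0 u0')
  \<comment> \<open>D is q q' (a/q - a'/q' - c), with c accounting for wrap-around modulo 1. It is
    an integer with M |D| < M, hence zero.\<close>
  define D where "D = int a * int q' - int a' * int q - c * int q * int q'"
  have "(int a * int u + j - (int a' * int u' + j')) * (int q * int q') = int M * c * (int q * int q')"
    by (simp only: c)
  moreover have "int a * int u * (int q * int q') = int a * int q' * int M"
    by (simp add: u(1))
  moreover have "int a' * int u' * (int q * int q') = int a' * int q * int M"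
    by (simp add: u(2))
  moreover have "int M * D = int a * int q' * int M - int a' * int q * int M - int M * c * (int q * int q')"
    by (simp add: D_def algebra_simps)
  ultimately have key: "int M * D = - ((j - j') * (int q * int q'))"
    by (simp only: left_diff_distrib distrib_right)
  have "\<bar>int M * D\<bar> = \<bar>j - j'\<bar> * (int q * int q')"
    unfolding key by (simp add: abs_mult)
  also have "\<dots> \<le> (2 * int J) * (int X * int X)"
    using j j' q q' by (intro mult_mono) auto
  also have "\<dots> < int M" using M q by (simp add: power2_eq_square)
  finally have "\<bar>int M\<bar> * \<bar>D\<bar> < int M" by (simp add: abs_mult)
  then have D: "D = 0"
    by (smt (verit) mult_le_cancel_left1 of_nat_0_le_iff)
  have jj: "j = j'" using key D q q' by simp
  have e1: "int a * int q' = int q * (int a' + c * int q')" using D by (simp add: D_def algebra_simps)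
  have e2: "int a' * int q = int q' * (int a - c * int q)" using D by (simp add: D_def algebra_simps)
  have "int q dvd int a * int q'" using e1 by simp
  then have "q dvd a * q'" by (simp flip: of_nat_mult)
  then have 1: "q dvd q'" using a(1) by (simp add: coprime_dvd_mult_right_iff coprime_commute)
  have "int q' dvd int a' * int q" using e2 by simp
  then have "q' dvd a' * q" by (simp flip: of_nat_mult)
  then have 2: "q' dvd q" using a'(1) by (simp add: coprime_dvd_mult_right_iff coprime_commute)
  have qq: "q = q'" using 1 2 by (rule dvd_antisym)
  then have "int q * (int a - int a' - c * int q) = 0" using D by (simp add: D_def algebra_simps)
  then have "int a - int a' = int q * c" using q by simp
  then have "int q dvd int a - int a'" by simp
  \<comment> \<open>Totatives lie in {0<..q}, so two of them congruent modulo q coincide.\<close>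
  moreover have "\<bar>int a - int a'\<bar> < int q" using a a' qq by auto
  ultimately have "int a - int a' = 0" using dvd_imp_le_int[of "int a - int a'" "int q"] by linarith
  then show ?thesis using qq jj by (simp add: i_eq i'_eq)
qed

text \<open>The arcs occupy at least 1/24 of the grid: the totients sum to at least X^2/12, each arc
  has more than 2J points, and M = 4 X^2 J. This is the lower bound for the zeroth Fourier
  coefficient.\<close>

lemma card_arc_index_ge:
  assumes "M = 4 * X\<^sup>2 * J"
  shows "M \<le> 24 * card (arc_index X J)"
proof -
  have "card (arc_index X J) = (\<Sum>q\<in>denominators X. totient q) * (2 * J + 1)"
    by (simp add: arc_index_def card_cartesian_product totient_def nat_add_distrib nat_mult_distrib) 
  then have "24 * card (arc_index X J) \<ge> 2 * (12 * (\<Sum>q\<in>denominators X. totient q)) * (2 * J)"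
    by simp
  moreover have "2 * X\<^sup>2 * (2 * J) \<le> 2 * (12 * (\<Sum>q\<in>denominators X. totient q)) * (2 * J)"
    using sum_totient_denominators_ge[of X] by (intro mult_right_mono mult_left_mono) auto
  ultimately have "2 * X\<^sup>2 * (2 * J) \<le> 24 * card (arc_index X J)" by (rule order_trans[rotated])
  then show ?thesis using assms by simp
qed

section \<open>Fourier coefficients of the arcs\<close>

lemma norm_dirichlet_kernel_le:
  "norm (\<Sum>j\<in>{- int J..int J}. e2pi (of_int j * \<theta>)) * norm (1 - e2pi \<theta>) \<le> 2"
proof -
  have "(\<Sum>j\<in>{- int J..int J}. e2pi (of_int j * \<theta>)) * (1 - e2pi \<theta>)
      = e2pi (of_int (- int J) * \<theta>) - e2pi (of_int (int J + 1) * \<theta>)"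
  proof (induction J)
    case 0
    then show ?case by simp
  next
    case (Suc J)
    have "{- int (Suc J)..int (Suc J)} = insert (- int J - 1) (insert (int J + 1) {- int J..int J})"
      by auto
    then have "(\<Sum>j\<in>{- int (Suc J)..int (Suc J)}. e2pi (of_int j * \<theta>)) * (1 - e2pi \<theta>)
        = e2pi (of_int (- int J - 1) * \<theta>) * (1 - e2pi \<theta>) + e2pi (of_int (int J + 1) * \<theta>) * (1 - e2pi \<theta>)
          + (\<Sum>j\<in>{- int J..int J}. e2pi (of_int j * \<theta>)) * (1 - e2pi \<theta>)"
      by (simp add: distrib_right)
    also note Suc
    also have "e2pi (of_int (- int J - 1) * \<theta>) * (1 - e2pi \<theta>)
        = e2pi (of_int (- int (Suc J)) * \<theta>) - e2pi (of_int (- int J) * \<theta>)"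
      unfolding right_diff_distrib mult_1_right e2pi_add[symmetric]
      by (intro arg_cong2[of _ _ _ _ minus] arg_cong[of _ _ e2pi]) (simp_all add: algebra_simps)
    also have "e2pi (of_int (int J + 1) * \<theta>) * (1 - e2pi \<theta>)
        = e2pi (of_int (int J + 1) * \<theta>) - e2pi (of_int (int (Suc J) + 1) * \<theta>)"
      unfolding right_diff_distrib mult_1_right e2pi_add[symmetric]
      by (intro arg_cong2[of _ _ _ _ minus] arg_cong[of _ _ e2pi]) (simp_all add: algebra_simps)
    finally show ?case by simp
  qed
  then have "norm (\<Sum>j\<in>{- int J..int J}. e2pi (of_int j * \<theta>)) * norm (1 - e2pi \<theta>)
      = norm (e2pi (of_int (- int J) * \<theta>) - e2pi (of_int (int J + 1) * \<theta>))"
    unfolding norm_mult[symmetric] by (simp only:)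
  also have "\<dots> \<le> 1 + 1"
    by (rule order_trans[OF norm_triangle_ineq4]) simp
  finally show ?thesis by simp
qed

text \<open>After exchanging the sums, each divisor d of k is weighted by d times the number of its
  multiples among the q, which is at most X. Averaging over q therefore costs X times the divisor
  count of k, instead of X^2.\<close>

lemma sum_ramanujan_bound:
  fixes k :: int
  assumes "k \<noteq> 0"
  shows "(\<Sum>q\<in>denominators X. norm (\<Sum>a\<in>totatives q. e2pi (of_int k * real a / real q)))
    \<le> real X * real (card {d. d dvd nat \<bar>k\<bar>})"
proof -
  define K where "K = nat \<bar>k\<bar>"
  have K: "K > 0" "int d dvd k \<longleftrightarrow> d dvd K" for d
    using assms by (auto simp: K_def int_dvd_int_iff[symmetric] simp del: int_dvd_int_iff)
  have fin: "finite {d. d dvd K}" using K by simp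
  have "(\<Sum>q\<in>denominators X. norm (\<Sum>a\<in>totatives q. e2pi (of_int k * real a / real q)))
      \<le> (\<Sum>q\<in>denominators X. real (\<Sum>d | d dvd q \<and> int d dvd k. d))"
    by (intro sum_mono norm_ramanujan_sum_le) (auto simp: denominators_def)
  also have "\<dots> = real (\<Sum>q\<in>denominators X. \<Sum>d | d dvd K. if d dvd q then d else 0)"
    using fin by (simp add: K sum.inter_filter[symmetric] conj_commute)
  also have "(\<Sum>q\<in>denominators X. \<Sum>d | d dvd K. if d dvd q then d else 0)
      = (\<Sum>d | d dvd K. \<Sum>q\<in>denominators X. if d dvd q then d else 0)"
    by (rule sum.swap)
  also have "\<dots> \<le> (\<Sum>d | d dvd K. X)"
  proof (intro sum_mono)
    fix d assume "d \<in> {d. d dvd K}"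
    then have d: "d > 0" using K by (auto intro: dvd_pos_nat)
    have "(\<Sum>q\<in>denominators X. if d dvd q then d else 0) = card {q\<in>denominators X. d dvd q} * d"
      by (simp add: sum.inter_filter[symmetric])
    also have "\<dots> \<le> card {n\<in>{1..X}. d dvd n} * d"
      by (intro mult_right_mono card_mono) (auto simp: denominators_def)
    also have "\<dots> \<le> X" using mult_card_multiples_le[OF d, of X] by (simp add: mult.commute)
    finally show "(\<Sum>q\<in>denominators X. if d dvd q then d else 0) \<le> X" .
  qed
  finally show ?thesis by (simp add: K_def mult.commute)
qed

text \<open>The coefficient factors into a sum of Ramanujan sums, at most X times the divisor count
  of k, and a Dirichlet kernel, at most min(M/X^2, M/|k|). The decay in k is essential: k ranges up
  to M/2, which no power of X bounds, so |k|^delta cannot be estimated by itself.\<close>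

lemma arc_fourier_bound:
  fixes \<delta> :: real
  assumes \<delta>: "0 < \<delta>" "\<delta> \<le> 1"
  shows "\<exists>C > 0. \<forall>(X :: nat) J M (k :: int). X \<ge> 1 \<longrightarrow> J \<ge> 1 \<longrightarrow> M = 4 * X\<^sup>2 * J \<longrightarrow>
      (\<forall>q. 1 \<le> q \<longrightarrow> q \<le> X \<longrightarrow> q dvd M) \<longrightarrow> k \<noteq> 0 \<longrightarrow> 2 * \<bar>k\<bar> \<le> int M \<longrightarrow>
      norm (\<Sum>i\<in>arc_index X J. e2pi (of_int k * of_int (arc_point M i) / real M))
        \<le> C * real M * real X powr (2 * \<delta> - 1)"
proof -
  obtain C where C: "C > 0" "\<And>n. n \<ge> 1 \<Longrightarrow> real (card {d. d dvd n}) \<le> C * real n powr \<delta>"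
    using divisor_count_bound[OF \<delta>(1)] by blast
  have "norm (\<Sum>i\<in>arc_index X J. e2pi (of_int k * of_int (arc_point M i) / real M))
        \<le> C * real M * real X powr (2 * \<delta> - 1)"
    if X: "X \<ge> 1" and J: "J \<ge> 1" and M: "M = 4 * X\<^sup>2 * J"
      and dvd: "\<And>q. 1 \<le> q \<Longrightarrow> q \<le> X \<Longrightarrow> q dvd M" and k: "k \<noteq> 0" "2 * \<bar>k\<bar> \<le> int M"
    for X J M :: nat and k :: int
  proof -
    have M0: "M > 0" using X J M by simp
    define \<theta> where "\<theta> = of_int k / real M"
    define D where "D = (\<Sum>j\<in>{- int J..int J}. e2pi (of_int j * \<theta>))"
    define R where "R q = (\<Sum>a\<in>totatives q. e2pi (of_int k * real a / real q))" for q
    have "(\<Sum>i\<in>arc_index X J. e2pi (of_int k * of_int (arc_point M i) / real M))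
      = (\<Sum>p\<in>Sigma (denominators X) totatives. \<Sum>j\<in>{- int J..int J}.
          e2pi (of_int k * of_int (arc_point M (p, j)) / real M))"
      unfolding arc_index_def by (subst sum.cartesian_product) simp
    also have "\<dots> = (\<Sum>p\<in>Sigma (denominators X) totatives. e2pi (of_int k * real (snd p) / real (fst p)) * D)"
    proof (intro sum.cong refl)
      fix p assume "p \<in> Sigma (denominators X) totatives"
      then obtain q a where p: "p = (q, a)" and q: "q \<in> denominators X" by auto
      have q0: "q > 0" using q by (auto simp: denominators_def)
      have "q dvd M" using dvd[of q] q q0 by (auto simp: denominators_def)
      then have "real (M div q) = real M / real q" by (simp add: real_of_nat_div)
      then have "of_int k * of_int (arc_point M (p, j)) / real M = of_int k * real a / real q + of_int j * \<theta>" for j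
        using M0 q0 by (simp add: p arc_point_def \<theta>_def field_simps)
      then show "(\<Sum>j\<in>{- int J..int J}. e2pi (of_int k * of_int (arc_point M (p, j)) / real M))
          = e2pi (of_int k * real (snd p) / real (fst p)) * D"
        by (simp add: p D_def e2pi_add sum_distrib_left)
    qed
    also have "\<dots> = (\<Sum>(q, a)\<in>Sigma (denominators X) totatives. e2pi (of_int k * real a / real q) * D)"
      by (simp add: split_def)
    also have "\<dots> = (\<Sum>q\<in>denominators X. \<Sum>a\<in>totatives q. e2pi (of_int k * real a / real q) * D)"
      by (rule sum.Sigma[symmetric]) auto
    also have "\<dots> = (\<Sum>q\<in>denominators X. R q) * D"
      by (simp add: R_def sum_distrib_right)
    finally have eq: "norm (\<Sum>i\<in>arc_index X J. e2pi (of_int k * of_int (arc_point M i) / real M))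
        = norm (\<Sum>q\<in>denominators X. R q) * norm D"
      by (simp only: norm_mult)
    define K where "K = real_of_int \<bar>k\<bar>"
    have K: "K \<ge> 1" "real (nat \<bar>k\<bar>) = K" using k by (auto simp: K_def)
    have "norm (\<Sum>q\<in>denominators X. R q) \<le> (\<Sum>q\<in>denominators X. norm (R q))"
      by (rule norm_sum)
    also have "\<dots> \<le> real X * real (card {d. d dvd nat \<bar>k\<bar>})"
      unfolding R_def by (rule sum_ramanujan_bound[OF k(1)])
    also have "\<dots> \<le> real X * (C * K powr \<delta>)"
      using C(2)[of "nat \<bar>k\<bar>"] k K by (intro mult_left_mono) auto
    finally have Rb: "norm (\<Sum>q\<in>denominators X. R q) \<le> real X * (C * K powr \<delta>)" .
    have "norm D \<le> (\<Sum>j\<in>{- int J..int J}. 1)"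
      unfolding D_def by (rule sum_norm_le) simp
    also have "\<dots> \<le> 4 * real J" using J by simp
    also have "\<dots> = real M / (real X)\<^sup>2" using X by (simp add: M)
    finally have D1: "norm D \<le> real M / (real X)\<^sup>2" .
    have th: "\<bar>\<theta>\<bar> = K / real M" by (simp add: \<theta>_def K_def)
    have "4 * \<bar>\<theta>\<bar> \<le> norm (1 - e2pi \<theta>)"
    proof (rule norm_one_minus_e2pi_ge)
      have "real_of_int (2 * \<bar>k\<bar>) \<le> real_of_int (int M)" using k(2) by (simp only: of_int_le_iff)
      then show "\<bar>\<theta>\<bar> \<le> 1 / 2" using M0 unfolding th K_def by (simp add: field_simps)
    qed
    then have "norm D * (4 * (K / real M)) \<le> norm D * norm (1 - e2pi \<theta>)"
      unfolding th by (intro mult_left_mono) auto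
    also have "\<dots> \<le> 2" unfolding D_def by (rule norm_dirichlet_kernel_le)
    finally have "norm D * (4 * K) \<le> 2 * real M" using M0 by (simp add: field_simps)
    moreover have "0 \<le> norm D * K" "norm D * (4 * K) = 4 * (norm D * K)" using K by simp_all
    ultimately have "norm D * K \<le> real M" by linarith
    then have D2: "norm D \<le> real M / K" using K by (simp add: field_simps)
    \<comment> \<open>Up to |k| = X^2 the trivial bound for the kernel wins, beyond it the decay;
      there the exponent delta - 1 <= 0 makes the value at X^2 an upper bound.\<close>
    have main: "K powr \<delta> * norm D \<le> real M * (real X)\<^sup>2 powr (\<delta> - 1)"
    proof (cases "K \<le> (real X)\<^sup>2")
      case True
      have "K powr \<delta> * norm D \<le> (real X)\<^sup>2 powr \<delta> * (real M / (real X)\<^sup>2)"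
        using True K \<delta> D1 by (intro mult_mono powr_mono2) auto
      also have "\<dots> = real M * (real X)\<^sup>2 powr (\<delta> - 1)" using X by (simp add: powr_diff)
      finally show ?thesis .
    next
      case False
      have "K powr \<delta> * norm D \<le> K powr \<delta> * (real M / K)"
        using D2 by (intro mult_left_mono) auto
      also have "\<dots> = real M * K powr (\<delta> - 1)" using K by (simp add: powr_diff)
      also have "\<dots> \<le> real M * (real X)\<^sup>2 powr (\<delta> - 1)"
        using False X \<delta> by (intro mult_left_mono powr_mono2') auto
      finally show ?thesis .
    qed
    have pw: "real X * (real X)\<^sup>2 powr (\<delta> - 1) = real X powr (2 * \<delta> - 1)"
    proof -
      have "(real X)\<^sup>2 powr (\<delta> - 1) = real X powr (2 * (\<delta> - 1))"
        unfolding powr_powr[symmetric] using X by simp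
      then have "real X * (real X)\<^sup>2 powr (\<delta> - 1) = real X powr 1 * real X powr (2 * (\<delta> - 1))"
        using X by simp
      also have "\<dots> = real X powr (2 * \<delta> - 1)" unfolding powr_add[symmetric] by (simp add: algebra_simps)
      finally show ?thesis .
    qed
    have "norm (\<Sum>q\<in>denominators X. R q) * norm D \<le> real X * (C * K powr \<delta>) * norm D"
      using Rb by (intro mult_right_mono) auto
    also have "\<dots> = real X * C * (K powr \<delta> * norm D)" by (simp add: mult_ac)
    also have "\<dots> \<le> real X * C * (real M * (real X)\<^sup>2 powr (\<delta> - 1))"
      using main C(1) by (intro mult_left_mono) auto
    also have "\<dots> = C * real M * (real X * (real X)\<^sup>2 powr (\<delta> - 1))" by (simp add: mult_ac)
    finally show ?thesis unfolding eq pw .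
  qed
  then show ?thesis using C(1) by blast
qed

section \<open>Duality on a finite grid\<close>

definition vec_box :: "int set \<Rightarrow> (int ^ 'd::finite) set" where
  "vec_box A = {n. \<forall>j. n $ j \<in> A}"

lemma bij_betw_vec_box: "bij_betw vec_lambda (Pi\<^sub>E UNIV (\<lambda>_. A)) (vec_box A)"
  by (rule bij_betw_byWitness[of _ vec_nth]) (auto simp: vec_box_def)

lemma finite_vec_box:
  assumes "finite A"
  shows "finite (vec_box A :: (int ^ 'd::finite) set)"
proof -
  have "finite (Pi\<^sub>E (UNIV :: 'd set) (\<lambda>_. A))"
    using assms by (intro finite_PiE) auto
  then show ?thesis
    using bij_betw_finite[OF bij_betw_vec_box] by blast
qed

lemma sum_vec_box_prod:
  fixes f :: "'d::finite \<Rightarrow> int \<Rightarrow> 'a::comm_semiring_1"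
  assumes "finite A"
  shows "(\<Sum>n\<in>vec_box A. \<Prod>j\<in>UNIV. f j (n $ j)) = (\<Prod>j\<in>UNIV. \<Sum>m\<in>A. f j m)"
proof -
  have "(\<Sum>n\<in>vec_box A. \<Prod>j\<in>UNIV. f j (n $ j)) = (\<Sum>g\<in>Pi\<^sub>E UNIV (\<lambda>_. A). \<Prod>j\<in>UNIV. f j (vec_lambda g $ j))"
    by (rule sum.reindex_bij_betw[OF bij_betw_vec_box, symmetric])
  also have "\<dots> = (\<Prod>j\<in>UNIV. \<Sum>m\<in>A. f j m)"
    using assms by (subst prod_sum_PiE) auto
  finally show ?thesis .
qed

definition int_inner :: "int ^ 'd::finite \<Rightarrow> int ^ 'd \<Rightarrow> int" where
  "int_inner n g = (\<Sum>j\<in>UNIV. n $ j * g $ j)"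

lemma int_inner_diff: "int_inner n (g - g') = int_inner n g - int_inner n g'"
  by (simp add: int_inner_def right_diff_distrib sum_subtractf)

text \<open>The Fourier transform on the group (Z/M)^(d+1) of \<open>c\<close> restricted to
  \<open>G\<close>, at the frequency (n, k).\<close>

definition grid_sum :: "nat \<Rightarrow> ((int ^ 'd::finite) \<times> int) set \<Rightarrow> ((int ^ 'd) \<times> int \<Rightarrow> complex)
    \<Rightarrow> int ^ 'd \<Rightarrow> int \<Rightarrow> complex" where
  "grid_sum M G c n k = (\<Sum>p\<in>G. c p * e2pi (of_int (int_inner n (fst p) + k * snd p) / real M))"

lemma sum_swap_pairs:
  "(\<Sum>n\<in>A. \<Sum>k\<in>B. \<Sum>p\<in>C. \<Sum>q\<in>D. f n k p q) = (\<Sum>p\<in>C. \<Sum>q\<in>D. \<Sum>n\<in>A. \<Sum>k\<in>B. f n k p q)"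
proof -
  have "(\<Sum>n\<in>A. \<Sum>k\<in>B. \<Sum>p\<in>C. \<Sum>q\<in>D. f n k p q) = (\<Sum>n\<in>A. \<Sum>p\<in>C. \<Sum>k\<in>B. \<Sum>q\<in>D. f n k p q)"
    by (rule sum.cong[OF refl], rule sum.swap)
  also have "\<dots> = (\<Sum>p\<in>C. \<Sum>n\<in>A. \<Sum>k\<in>B. \<Sum>q\<in>D. f n k p q)"
    by (rule sum.swap)
  also have "\<dots> = (\<Sum>p\<in>C. \<Sum>n\<in>A. \<Sum>q\<in>D. \<Sum>k\<in>B. f n k p q)"
    by (rule sum.cong[OF refl], rule sum.cong[OF refl], rule sum.swap)
  also have "\<dots> = (\<Sum>p\<in>C. \<Sum>q\<in>D. \<Sum>n\<in>A. \<Sum>k\<in>B. f n k p q)"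
    by (rule sum.cong[OF refl], rule sum.swap)
  finally show ?thesis .
qed

lemma sum_e2pi_symmetric:
  fixes K M :: nat
  assumes "M = 2 * K" "M > 0"
  shows "(\<Sum>j\<in>{- int K..<int K}. e2pi (of_int (k * j) / real M)) = (if int M dvd k then of_nat M else 0)"
  using sum_e2pi_complete[of "int M" k "- int K"] assms by simp

text \<open>Time frequencies are measured from the paraboloid, as |n|^2 + k. The phase then splits,
  and weights \<open>b\<close> in k multiply the kernel by a function of the time difference alone.
  Parseval uses constant weights; the duality argument uses the Fourier coefficients of the
  arcs.\<close>

lemma grid_sum_expand:
  fixes G :: "((int ^ 'd::finite) \<times> int) set" and a :: "int ^ 'd \<Rightarrow> complex" and b :: "int \<Rightarrow> complex"
  shows "(\<Sum>n\<in>B. a n * (\<Sum>k\<in>K. b k * of_real ((norm (grid_sum M G c n (int_norm_sq n + k)))\<^sup>2)))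
    = (\<Sum>p\<in>G. \<Sum>p'\<in>G. c p * cnj (c p')
        * (\<Sum>n\<in>B. a n * e2pi (of_int (int_inner n (fst p - fst p') + int_norm_sq n * (snd p - snd p')) / real M))
        * (\<Sum>k\<in>K. b k * e2pi (of_int (k * (snd p - snd p')) / real M)))"
proof -
  define E where "E p n k = e2pi (of_int (int_inner n (fst p) + (int_norm_sq n + k) * snd p) / real M)"
    for p and n :: "int ^ 'd" and k
  define E1 where "E1 n p p' = e2pi (of_int (int_inner n (fst p - fst p') + int_norm_sq n * (snd p - snd p')) / real M)"
    for n and p p' :: "(int ^ 'd) \<times> int"
  define E2 where "E2 k p p' = e2pi (of_int (k * (snd p - snd p')) / real M)" for k and p p' :: "(int ^ 'd) \<times> int"
  have E: "E p n k * cnj (E p' n k) = E1 n p p' * E2 k p p'" for p p' n k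
    unfolding E_def E1_def E2_def e2pi_diff[symmetric] e2pi_add[symmetric]
      diff_divide_distrib[symmetric] add_divide_distrib[symmetric] of_int_diff[symmetric] of_int_add[symmetric]
    by (intro arg_cong[of _ _ e2pi] arg_cong2[of _ _ _ _ "(/)"] arg_cong[of _ _ of_int] refl)
       (simp add: int_inner_diff algebra_simps)
  have sq: "of_real ((norm (grid_sum M G c n (int_norm_sq n + k)))\<^sup>2)
      = (\<Sum>p\<in>G. \<Sum>p'\<in>G. c p * cnj (c p') * (E1 n p p' * E2 k p p'))" for n k
  proof -
    have "of_real ((norm (grid_sum M G c n (int_norm_sq n + k)))\<^sup>2)
        = (\<Sum>p\<in>G. c p * E p n k) * cnj (\<Sum>p\<in>G. c p * E p n k)"
      unfolding grid_sum_def E_def by (rule complex_norm_square)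
    also have "\<dots> = (\<Sum>p\<in>G. \<Sum>p'\<in>G. (c p * E p n k) * (cnj (c p') * cnj (E p' n k)))"
      by (simp add: sum_product)
    also have "\<dots> = (\<Sum>p\<in>G. \<Sum>p'\<in>G. c p * cnj (c p') * (E1 n p p' * E2 k p p'))"
      by (intro sum.cong refl) (simp add: E[symmetric] mult_ac)
    finally show ?thesis .
  qed
  have "(\<Sum>n\<in>B. a n * (\<Sum>k\<in>K. b k * of_real ((norm (grid_sum M G c n (int_norm_sq n + k)))\<^sup>2)))
      = (\<Sum>n\<in>B. \<Sum>k\<in>K. \<Sum>p\<in>G. \<Sum>p'\<in>G. c p * cnj (c p') * ((a n * E1 n p p') * (b k * E2 k p p')))"
    unfolding sq sum_distrib_left by (intro sum.cong refl) (simp add: mult_ac)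
  also have "\<dots> = (\<Sum>p\<in>G. \<Sum>p'\<in>G. \<Sum>n\<in>B. \<Sum>k\<in>K. c p * cnj (c p') * ((a n * E1 n p p') * (b k * E2 k p p')))"
    by (rule sum_swap_pairs)
  also have "\<dots> = (\<Sum>p\<in>G. \<Sum>p'\<in>G. c p * cnj (c p') * ((\<Sum>n\<in>B. a n * E1 n p p') * (\<Sum>k\<in>K. b k * E2 k p p')))"
    unfolding sum_product unfolding sum_distrib_left ..
  finally show ?thesis unfolding E1_def E2_def by (simp only: mult.assoc)
qed

lemma e2pi_int_inner_eq_prod:
  "e2pi (of_int (int_inner n u + int_norm_sq n * s) / real M)
    = (\<Prod>j\<in>UNIV. e2pi (of_int (n $ j) * (of_int (u $ j) / real M) + of_int ((n $ j)\<^sup>2) * (of_int s / real M)))"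
  unfolding e2pi_sum[symmetric]
  by (rule arg_cong[of _ _ e2pi])
     (simp add: int_inner_def int_norm_sq_def sum.distrib sum_divide_distrib sum_distrib_right add_divide_distrib)

lemma sum_e2pi_int_inner:
  fixes u :: "int ^ 'd::finite" and K M :: nat
  assumes "M = 2 * K" "M > 0"
  shows "(\<Sum>n\<in>vec_box {- int K..<int K}. e2pi (of_int (int_inner n u) / real M))
    = (if \<forall>j. int M dvd u $ j then of_nat M ^ CARD('d) else 0)"
proof -
  have "(\<Sum>n\<in>vec_box {- int K..<int K}. e2pi (of_int (int_inner n u) / real M))
      = (\<Sum>n\<in>vec_box {- int K..<int K}. \<Prod>j\<in>UNIV. e2pi (of_int (u $ j * (n $ j)) / real M))"
    using e2pi_int_inner_eq_prod[of _ u 0 M] by (intro sum.cong refl) (simp add: mult.commute)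
  also have "\<dots> = (\<Prod>j\<in>UNIV. \<Sum>m\<in>{- int K..<int K}. e2pi (of_int (u $ j * m) / real M))"
    by (rule sum_vec_box_prod) simp
  also have "\<dots> = (\<Prod>j\<in>UNIV. if int M dvd u $ j then of_nat M else 0)"
    by (simp only: sum_e2pi_symmetric[OF assms])
  also have "\<dots> = (if \<forall>j. int M dvd u $ j then of_nat M ^ CARD('d) else 0)"
    by (auto simp: prod_zero_iff)
  finally show ?thesis .
qed

text \<open>For each n the numbers |n|^2 + k run through a complete residue system modulo M, so the
  shift to the paraboloid leaves the total unchanged.\<close>

lemma grid_sum_parseval:
  fixes G :: "((int ^ 'd::finite) \<times> int) set" and K M :: nat
  assumes M: "M = 2 * K" "M > 0" and G: "G \<subseteq> vec_box {0..<int M} \<times> {0..<int M}"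
  shows "(\<Sum>n\<in>vec_box {- int K..<int K}. \<Sum>k\<in>{- int K..<int K}. (norm (grid_sum M G c n (int_norm_sq n + k)))\<^sup>2)
    = real M ^ (CARD('d) + 1) * (\<Sum>p\<in>G. (norm (c p))\<^sup>2)"
proof -
  let ?K = "{- int K..<int K}"
  have finG: "finite G"
    using G by (rule finite_subset) (simp add: finite_vec_box)
  have k_sum: "(\<Sum>k\<in>?K. 1 * e2pi (of_int (k * s) / real M)) = (if int M dvd s then of_nat M else 0)" for s
    using sum_e2pi_symmetric[OF M, of s] by (simp add: mult.commute)
  have "complex_of_real (\<Sum>n\<in>vec_box ?K. \<Sum>k\<in>?K. (norm (grid_sum M G c n (int_norm_sq n + k)))\<^sup>2)
      = (\<Sum>n\<in>vec_box ?K. 1 * (\<Sum>k\<in>?K. 1 * of_real ((norm (grid_sum M G c n (int_norm_sq n + k)))\<^sup>2)))"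
    by simp
  also have "\<dots> = (\<Sum>p\<in>G. \<Sum>p'\<in>G. c p * cnj (c p')
      * (\<Sum>n\<in>vec_box ?K. 1 * e2pi (of_int (int_inner n (fst p - fst p') + int_norm_sq n * (snd p - snd p')) / real M))
      * (\<Sum>k\<in>?K. 1 * e2pi (of_int (k * (snd p - snd p')) / real M)))"
    by (rule grid_sum_expand)
  also have "\<dots> = (\<Sum>p\<in>G. \<Sum>p'\<in>G. if p' = p then of_real (real M ^ (CARD('d) + 1) * (norm (c p))\<^sup>2) else 0)"
  proof (intro sum.cong refl)
    fix p p' assume p: "p \<in> G" "p' \<in> G"
    \<comment> \<open>Coordinates of points of \<open>G\<close> lie in {0..<M}, so congruence modulo
      M is equality and only the diagonal survives.\<close>
    have small: "x = 0" if "int M dvd x" "\<bar>x\<bar> < int M" for x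
      using that dvd_imp_le_int[of x "int M"] by linarith
    have "snd p \<in> {0..<int M}" "snd p' \<in> {0..<int M}" using p G by auto
    then have "\<bar>snd p - snd p'\<bar> < int M" by auto
    then have s: "int M dvd snd p - snd p' \<longleftrightarrow> snd p = snd p'"
      using small[of "snd p - snd p'"] by auto
    have u: "int M dvd (fst p - fst p') $ j \<longleftrightarrow> fst p $ j = fst p' $ j" for j
    proof -
      have "fst p \<in> vec_box {0..<int M}" "fst p' \<in> vec_box {0..<int M}" using p G by auto
      then have "fst p $ j \<in> {0..<int M}" "fst p' $ j \<in> {0..<int M}"
        unfolding vec_box_def by blast+
      then show ?thesis using small[of "fst p $ j - fst p' $ j"] by auto
    qed
    show "c p * cnj (c p')
      * (\<Sum>n\<in>vec_box ?K. 1 * e2pi (of_int (int_inner n (fst p - fst p') + int_norm_sq n * (snd p - snd p')) / real M))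
      * (\<Sum>k\<in>?K. 1 * e2pi (of_int (k * (snd p - snd p')) / real M))
      = (if p' = p then of_real (real M ^ (CARD('d) + 1) * (norm (c p))\<^sup>2) else 0)"
    proof (cases "snd p = snd p'")
      case True
      have "(\<forall>j. int M dvd (fst p - fst p') $ j) \<longleftrightarrow> p' = p"
        unfolding u using True by (auto simp: vec_eq_iff prod_eq_iff)
      then show ?thesis
        unfolding k_sum s using True sum_e2pi_int_inner[OF M, of "fst p - fst p'"]
        by (simp add: complex_norm_square[symmetric] mult_ac)
    next
      case False
      then show ?thesis unfolding k_sum s by auto
    qed
  qed
  also have "\<dots> = complex_of_real (real M ^ (CARD('d) + 1) * (\<Sum>p\<in>G. (norm (c p))\<^sup>2))"
    using finG by (simp add: sum_distrib_left)
  finally show ?thesis by (simp only: of_real_eq_iff)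
qed

text \<open>The kernel is a product over the coordinates of one-dimensional Weyl sums with a common
  time, each bounded by \<open>\<kappa>\<close> uniformly in its linear phase.\<close>

lemma norm_tent_kernel_le:
  fixes u :: "int ^ 'd::finite"
  assumes "finite A" "\<And>x. norm (\<Sum>m\<in>A. of_int (tent N m) * e2pi (of_int m * x + of_int (m\<^sup>2) * (of_int s / real M))) \<le> \<kappa>"
  shows "norm (\<Sum>n\<in>vec_box A. of_int (\<Prod>j\<in>UNIV. tent N (n $ j))
      * e2pi (of_int (int_inner n u + int_norm_sq n * s) / real M)) \<le> \<kappa> ^ CARD('d)"
proof -
  have "(\<Sum>n\<in>vec_box A. of_int (\<Prod>j\<in>UNIV. tent N (n $ j)) * e2pi (of_int (int_inner n u + int_norm_sq n * s) / real M))
    = (\<Sum>n\<in>vec_box A. \<Prod>j\<in>UNIV. of_int (tent N (n $ j))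
        * e2pi (of_int (n $ j) * (of_int (u $ j) / real M) + of_int ((n $ j)\<^sup>2) * (of_int s / real M)))"
    by (simp only: e2pi_int_inner_eq_prod of_int_prod prod.distrib)
  also have "\<dots> = (\<Prod>j\<in>UNIV. \<Sum>m\<in>A. of_int (tent N m)
        * e2pi (of_int m * (of_int (u $ j) / real M) + of_int (m\<^sup>2) * (of_int s / real M)))"
    by (rule sum_vec_box_prod[OF assms(1)])
  finally have "norm (\<Sum>n\<in>vec_box A. of_int (\<Prod>j\<in>UNIV. tent N (n $ j))
      * e2pi (of_int (int_inner n u + int_norm_sq n * s) / real M))
    = (\<Prod>j\<in>UNIV. norm (\<Sum>m\<in>A. of_int (tent N m)
        * e2pi (of_int m * (of_int (u $ j) / real M) + of_int (m\<^sup>2) * (of_int s / real M))))"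
    by (simp only: prod_norm)
  also have "\<dots> \<le> (\<Prod>j\<in>(UNIV :: 'd set). \<kappa>)"
    by (intro prod_mono conjI norm_ge_zero assms(2))
  finally show ?thesis by simp
qed

text \<open>A single quantity T, the weighted energy with weights P k off the paraboloid, is
  evaluated twice. In physical space P becomes M times the indicator of the arcs, where the kernel
  is at most \<open>\<kappa>\<close> to the power d. In frequency space k = 0 is the sum to be
  bounded, and the other k are an error of relative size \<open>\<eta>\<close>.\<close>

lemma dual_inequality:
  fixes G :: "((int ^ 'd::finite) \<times> int) set" and c :: "(int ^ 'd) \<times> int \<Rightarrow> complex"
    and \<tau> :: "'i \<Rightarrow> int" and K M N :: nat
  assumes M: "M = 2 * K" "M > 0" and G: "G \<subseteq> vec_box {0..<int M} \<times> {0..<int M}"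
    and c: "\<And>p. p \<in> G \<Longrightarrow> norm (c p) \<le> 1"
    and fin: "finite I" and inj: "\<And>i i'. i \<in> I \<Longrightarrow> i' \<in> I \<Longrightarrow> int M dvd \<tau> i - \<tau> i' \<Longrightarrow> i = i'"
    and kernel: "\<And>i x. i \<in> I \<Longrightarrow> norm (\<Sum>m\<in>{- int K..<int K}. of_int (tent N m)
          * e2pi (of_int m * x + of_int (m\<^sup>2) * (of_int (\<tau> i) / real M))) \<le> \<kappa>"
    and fourier: "\<And>k. k \<noteq> 0 \<Longrightarrow> 2 * \<bar>k\<bar> \<le> int M \<Longrightarrow> norm (\<Sum>i\<in>I. e2pi (of_int k * of_int (\<tau> i) / real M)) \<le> \<eta>"
    and \<eta>: "\<eta> \<ge> 0" and \<kappa>: "\<kappa> \<ge> 0"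
  shows "real (card I) * (\<Sum>n\<in>vec_box {- int K..<int K}. of_int (\<Prod>j\<in>UNIV. tent N (n $ j)) * (norm (grid_sum M G c n (int_norm_sq n)))\<^sup>2)
    \<le> real M * \<kappa> ^ CARD('d) * (real (card G))\<^sup>2 + \<eta> * (2 * real N) ^ CARD('d) * real M ^ (CARD('d) + 1) * real (card G)"
proof -
  let ?K = "{- int K..<int K}"
  let ?d = "CARD('d)"
  define W where "W n = real_of_int (\<Prod>j\<in>UNIV. tent N (n $ j))" for n :: "int ^ 'd"
  define S where "S n k = (norm (grid_sum M G c n (int_norm_sq n + k)))\<^sup>2" for n k
  define P where "P k = (\<Sum>i\<in>I. e2pi (of_int (- k) * of_int (\<tau> i) / real M))" for k
  have finG: "finite G"
    using G by (rule finite_subset) (simp add: finite_vec_box)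
  have W: "0 \<le> W n" "W n \<le> (2 * real N) ^ ?d" for n
  proof -
    show "0 \<le> W n" unfolding W_def by (simp add: prod_nonneg tent_nonneg)
    have "(\<Prod>j\<in>UNIV. tent N (n $ j)) \<le> (\<Prod>j\<in>(UNIV :: 'd set). 2 * int N)"
      by (intro prod_mono conjI tent_nonneg tent_le)
    then have "W n \<le> real_of_int (\<Prod>j\<in>(UNIV :: 'd set). 2 * int N)"
      unfolding W_def of_int_le_iff .
    then show "W n \<le> (2 * real N) ^ ?d" by simp
  qed
  have Pb: "norm (P k) \<le> \<eta>" if "k \<in> ?K - {0}" for k
    unfolding P_def using that M by (intro fourier) auto
  have P0: "P 0 = of_nat (card I)" by (simp add: P_def)
  define T where "T = (\<Sum>n\<in>vec_box ?K. of_real (W n) * (\<Sum>k\<in>?K. P k * of_real (S n k)))"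
  have T_le: "norm T \<le> real M * \<kappa> ^ ?d * (real (card G))\<^sup>2"
  proof -
    have Psum: "(\<Sum>k\<in>?K. P k * e2pi (of_int (k * s) / real M)) = of_nat (M * card {i\<in>I. int M dvd s - \<tau> i})" for s
    proof -
      have "(\<Sum>k\<in>?K. P k * e2pi (of_int (k * s) / real M))
          = (\<Sum>k\<in>?K. \<Sum>i\<in>I. e2pi (of_int ((s - \<tau> i) * k) / real M))"
        unfolding P_def sum_distrib_right
      proof (intro sum.cong refl)
        fix k i
        have "of_int (- k) * of_int (\<tau> i) / real M + of_int (k * s) / real M = of_int ((s - \<tau> i) * k) / real M"
          unfolding add_divide_distrib[symmetric] by (simp add: algebra_simps)
        then show "e2pi (of_int (- k) * of_int (\<tau> i) / real M) * e2pi (of_int (k * s) / real M)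
            = e2pi (of_int ((s - \<tau> i) * k) / real M)"
          by (simp only: e2pi_add[symmetric])
      qed
      also have "\<dots> = (\<Sum>i\<in>I. \<Sum>k\<in>?K. e2pi (of_int ((s - \<tau> i) * k) / real M))"
        by (rule sum.swap)
      also have "\<dots> = (\<Sum>i\<in>I. if int M dvd s - \<tau> i then of_nat M else 0)"
        by (simp only: sum_e2pi_symmetric[OF M])
      also have "\<dots> = (\<Sum>i\<in>{i\<in>I. int M dvd s - \<tau> i}. of_nat M)"
        using fin by (rule sum.inter_filter[symmetric])
      finally show ?thesis by simp
    qed
    have "norm T = norm (\<Sum>p\<in>G. \<Sum>p'\<in>G. c p * cnj (c p')
        * (\<Sum>n\<in>vec_box ?K. of_real (W n) * e2pi (of_int (int_inner n (fst p - fst p') + int_norm_sq n * (snd p - snd p')) / real M))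
        * (\<Sum>k\<in>?K. P k * e2pi (of_int (k * (snd p - snd p')) / real M)))"
      unfolding T_def S_def by (rule arg_cong[OF grid_sum_expand])
    also have "\<dots> \<le> (\<Sum>p\<in>G. \<Sum>p'\<in>G. real M * \<kappa> ^ ?d)"
    proof (intro sum_norm_le)
      fix p p' assume p: "p \<in> G" "p' \<in> G"
      define u s where "u = fst p - fst p'" and "s = snd p - snd p'"
      define Q where "Q = (\<Sum>n\<in>vec_box ?K. of_real (W n) * e2pi (of_int (int_inner n u + int_norm_sq n * s) / real M))"
      have cc: "norm (c p * cnj (c p')) \<le> 1"
        using c[OF p(1)] c[OF p(2)] by (simp add: norm_mult mult_le_one)
      have "norm (Q * (\<Sum>k\<in>?K. P k * e2pi (of_int (k * s) / real M))) \<le> real M * \<kappa> ^ ?d"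
      \<comment> \<open>Off the arcs the inverse transform vanishes. On them injectivity leaves
        exactly one index, so its value is M and not a multiple of it.\<close>
      proof (cases "{i\<in>I. int M dvd s - \<tau> i} = {}")
        case True
        then have "card {i\<in>I. int M dvd s - \<tau> i} = 0" by (simp only: card.empty)
        then show ?thesis unfolding Psum using \<kappa> by simp
      next
        case False
        then obtain i where i: "i \<in> I" "int M dvd s - \<tau> i" by blast
        have "i' = i" if "i' \<in> I" "int M dvd s - \<tau> i'" for i'
        proof (rule inj[OF that(1) i(1)])
          show "int M dvd \<tau> i' - \<tau> i"
            using dvd_diff[OF i(2) that(2)] by simp
        qed
        then have "{i\<in>I. int M dvd s - \<tau> i} = {i}" using i by blast
        then have "card {i\<in>I. int M dvd s - \<tau> i} = 1" by simp
        moreover have "norm Q \<le> \<kappa> ^ ?d"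
          unfolding Q_def W_def of_real_of_int_eq
        proof (rule norm_tent_kernel_le)
          fix x
          have "(\<Sum>m\<in>?K. of_int (tent N m) * e2pi (of_int m * x + of_int (m\<^sup>2) * (of_int s / real M)))
            = (\<Sum>m\<in>?K. of_int (tent N m) * e2pi (of_int m * x + of_int (m\<^sup>2) * (of_int (\<tau> i) / real M)))"
          \<comment> \<open>Times congruent modulo M give the same kernel, because their phases
            differ by an integer multiple of m^2.\<close>
          proof (intro sum.cong refl arg_cong2[of _ _ _ _ "(*)"] e2pi_cong)
            fix m :: int
            obtain r where "s - \<tau> i = int M * r" using i(2) by (elim dvdE)
            then have "real_of_int (s - \<tau> i) = real_of_int (int M * r)" by (rule arg_cong)
            then have sr: "of_int s / real M - of_int (\<tau> i) / real M = of_int r"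
              using M by (simp add: field_simps)
            have "of_int m * x + of_int (m\<^sup>2) * (of_int s / real M) - (of_int m * x + of_int (m\<^sup>2) * (of_int (\<tau> i) / real M))
              = of_int (m\<^sup>2) * (of_int s / real M - of_int (\<tau> i) / real M)"
              by (simp only: right_diff_distrib add_diff_cancel_left)
            also have "\<dots> = of_int (m\<^sup>2 * r)" by (simp only: sr of_int_mult)
            finally have "of_int m * x + of_int (m\<^sup>2) * (of_int s / real M) - (of_int m * x + of_int (m\<^sup>2) * (of_int (\<tau> i) / real M))
              = of_int (m\<^sup>2 * r)" .
            then show "of_int m * x + of_int (m\<^sup>2) * (of_int s / real M) - (of_int m * x + of_int (m\<^sup>2) * (of_int (\<tau> i) / real M)) \<in> \<int>"
              by (simp only: Ints_of_int)
          qed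
          then show "norm (\<Sum>m\<in>?K. of_int (tent N m) * e2pi (of_int m * x + of_int (m\<^sup>2) * (of_int s / real M))) \<le> \<kappa>"
            using kernel[OF i(1), of x] by (simp only:)
        qed simp
        ultimately show ?thesis
          unfolding Psum by (simp add: norm_mult mult.commute mult_left_mono)
      qed
      then have "norm (c p * cnj (c p')) * norm (Q * (\<Sum>k\<in>?K. P k * e2pi (of_int (k * s) / real M))) \<le> 1 * (real M * \<kappa> ^ ?d)"
        using cc by (intro mult_mono) auto
      then show "norm (c p * cnj (c p')
        * (\<Sum>n\<in>vec_box ?K. of_real (W n) * e2pi (of_int (int_inner n (fst p - fst p') + int_norm_sq n * (snd p - snd p')) / real M))
        * (\<Sum>k\<in>?K. P k * e2pi (of_int (k * (snd p - snd p')) / real M))) \<le> real M * \<kappa> ^ ?d"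
        unfolding Q_def u_def s_def norm_mult[symmetric] mult.assoc mult_1_left .
    qed
    also have "\<dots> = real M * \<kappa> ^ ?d * (real (card G))\<^sup>2" by (simp add: power2_eq_square)
    finally show ?thesis .
  qed
  \<comment> \<open>The nonzero frequencies: the weight is replaced by its maximum (2N)^d, and
    Parseval handles what remains.\<close>
  define V where "V = (\<Sum>n\<in>vec_box ?K. of_real (W n) * (\<Sum>k\<in>?K - {0}. P k * of_real (S n k)))"
  have V_le: "norm V \<le> \<eta> * (2 * real N) ^ ?d * real M ^ (?d + 1) * real (card G)"
  proof -
    have "norm V \<le> (\<Sum>n\<in>vec_box ?K. (2 * real N) ^ ?d * (\<eta> * (\<Sum>k\<in>?K. S n k)))"
      unfolding V_def
    proof (rule sum_norm_le)
      fix n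
      have "norm (\<Sum>k\<in>?K - {0}. P k * of_real (S n k)) \<le> (\<Sum>k\<in>?K - {0}. \<eta> * S n k)"
      proof (rule sum_norm_le)
        fix k assume "k \<in> ?K - {0}"
        then have "norm (P k) * \<bar>S n k\<bar> \<le> \<eta> * \<bar>S n k\<bar>"
          by (intro mult_right_mono Pb) auto
        then show "norm (P k * of_real (S n k)) \<le> \<eta> * S n k"
          unfolding norm_mult norm_of_real by (simp add: S_def)
      qed
      also have "\<dots> \<le> (\<Sum>k\<in>?K. \<eta> * S n k)"
        using \<eta> by (intro sum_mono2) (auto simp: S_def)
      also have "\<dots> = \<eta> * (\<Sum>k\<in>?K. S n k)" by (rule sum_distrib_left[symmetric])
      finally have "norm (of_real (W n) :: complex) * norm (\<Sum>k\<in>?K - {0}. P k * of_real (S n k)) \<le> (2 * real N) ^ ?d * (\<eta> * (\<Sum>k\<in>?K. S n k))"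
        using W[of n] by (intro mult_mono) auto
      then show "norm (of_real (W n) * (\<Sum>k\<in>?K - {0}. P k * of_real (S n k))) \<le> (2 * real N) ^ ?d * (\<eta> * (\<Sum>k\<in>?K. S n k))"
        unfolding norm_mult .
    qed
    also have "\<dots> = \<eta> * (2 * real N) ^ ?d * (\<Sum>n\<in>vec_box ?K. \<Sum>k\<in>?K. S n k)"
      by (simp add: sum_distrib_left mult_ac)
    also have "(\<Sum>n\<in>vec_box ?K. \<Sum>k\<in>?K. S n k) = real M ^ (?d + 1) * (\<Sum>p\<in>G. (norm (c p))\<^sup>2)"
      unfolding S_def by (rule grid_sum_parseval[OF M G])
    also have "\<eta> * (2 * real N) ^ ?d * (real M ^ (?d + 1) * (\<Sum>p\<in>G. (norm (c p))\<^sup>2))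
        \<le> \<eta> * (2 * real N) ^ ?d * (real M ^ (?d + 1) * (\<Sum>p\<in>G. 1))"
      using \<eta> c by (intro mult_left_mono sum_mono) (auto simp: power_le_one)
    finally show ?thesis by (simp add: mult_ac)
  qed
  have "T = (\<Sum>n\<in>vec_box ?K. of_real (W n) * (P 0 * of_real (S n 0) + (\<Sum>k\<in>?K - {0}. P k * of_real (S n k))))"
    unfolding T_def using M by (intro sum.cong refl arg_cong2[of _ _ _ _ "(*)"] sum.remove) auto
  also have "\<dots> = of_real (real (card I) * (\<Sum>n\<in>vec_box ?K. W n * S n 0)) + V"
    unfolding V_def P0 by (simp add: distrib_left sum.distrib sum_distrib_left mult_ac)
  finally have "complex_of_real (real (card I) * (\<Sum>n\<in>vec_box ?K. W n * S n 0)) = T - V"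
    by simp
  then have "norm (complex_of_real (real (card I) * (\<Sum>n\<in>vec_box ?K. W n * S n 0))) \<le> norm T + norm V"
    using norm_triangle_ineq4 by metis
  then have "real (card I) * (\<Sum>n\<in>vec_box ?K. W n * S n 0) \<le> norm T + norm V"
    unfolding norm_of_real by linarith
  then show ?thesis
    using T_le V_le unfolding W_def S_def by simp
qed

text \<open>Pairing F with its conjugate phase on \<open>G\<close> gives at least lam * card G.
  Cauchy-Schwarz against the normalized coefficients moves this to the energy of the dual sums on
  the frequency box, where the tent weight is at least N^d.\<close>

lemma grid_large_values:
  fixes G :: "((int ^ 'd::finite) \<times> int) set" and b :: "int ^ 'd \<Rightarrow> complex"
    and \<tau> :: "'i \<Rightarrow> int" and K M N :: nat
  assumes M: "M = 2 * K" "M > 0" "N < K" and G: "G \<subseteq> vec_box {0..<int M} \<times> {0..<int M}"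
    and fin: "finite I" and inj: "\<And>i i'. i \<in> I \<Longrightarrow> i' \<in> I \<Longrightarrow> int M dvd \<tau> i - \<tau> i' \<Longrightarrow> i = i'"
    and kernel: "\<And>i x. i \<in> I \<Longrightarrow> norm (\<Sum>m\<in>{- int K..<int K}. of_int (tent N m)
          * e2pi (of_int m * x + of_int (m\<^sup>2) * (of_int (\<tau> i) / real M))) \<le> \<kappa>"
    and fourier: "\<And>k. k \<noteq> 0 \<Longrightarrow> 2 * \<bar>k\<bar> \<le> int M \<Longrightarrow> norm (\<Sum>i\<in>I. e2pi (of_int k * of_int (\<tau> i) / real M)) \<le> \<eta>"
    and \<eta>: "\<eta> \<ge> 0" and \<kappa>: "\<kappa> \<ge> 0" and lam: "lam \<ge> 0"
    and b: "(\<Sum>n\<in>freq_box N. (norm (b n))\<^sup>2) = 1"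
    and large: "\<And>p. p \<in> G \<Longrightarrow> lam < norm (\<Sum>n\<in>freq_box N. b n
          * e2pi (of_int (int_inner n (fst p) + int_norm_sq n * snd p) / real M))"
  shows "real (card I) * (real N ^ CARD('d) * (lam * real (card G))\<^sup>2)
    \<le> real M * \<kappa> ^ CARD('d) * (real (card G))\<^sup>2 + \<eta> * (2 * real N) ^ CARD('d) * real M ^ (CARD('d) + 1) * real (card G)"
proof -
  let ?K = "{- int K..<int K}"
  let ?d = "CARD('d)"
  define F where "F p = (\<Sum>n\<in>freq_box N. b n * e2pi (of_int (int_inner n (fst p) + int_norm_sq n * snd p) / real M))" for p
  \<comment> \<open>At a zero of F the division yields 0, which still satisfies both properties used
    below.\<close>
  define c where "c p = cnj (F p) / of_real (norm (F p))" for p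
  define S where "S n = grid_sum M G c n (int_norm_sq n)" for n
  have c: "norm (c p) \<le> 1" for p by (simp add: c_def norm_divide)
  have cF: "c p * F p = of_real (norm (F p))" for p
    using complex_norm_square[of "F p"] by (cases "F p = 0") (simp_all add: c_def power2_eq_square field_simps)
  have "lam * real (card G) = (\<Sum>p\<in>G. lam)" by simp
  also have "\<dots> \<le> (\<Sum>p\<in>G. norm (F p))"
    using large by (intro sum_mono) (auto simp: F_def less_imp_le)
  also have "\<dots> = norm (\<Sum>p\<in>G. complex_of_real (norm (F p)))"
    unfolding of_real_sum[symmetric] norm_of_real by (simp add: sum_nonneg)
  also have "(\<Sum>p\<in>G. complex_of_real (norm (F p))) = (\<Sum>p\<in>G. \<Sum>n\<in>freq_box N. b n * (c p
      * e2pi (of_int (int_inner n (fst p) + int_norm_sq n * snd p) / real M)))"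
    unfolding cF[symmetric] unfolding F_def sum_distrib_left by (intro sum.cong refl) (simp add: mult_ac)
  also have "\<dots> = (\<Sum>n\<in>freq_box N. b n * S n)"
    unfolding S_def grid_sum_def sum_distrib_left by (rule sum.swap)
  also have "norm (\<Sum>n\<in>freq_box N. b n * S n) \<le> (\<Sum>n\<in>freq_box N. \<bar>norm (b n)\<bar> * \<bar>norm (S n)\<bar>)"
    by (rule order_trans[OF norm_sum]) (simp add: norm_mult)
  also have "\<dots> \<le> L2_set (\<lambda>n. norm (b n)) (freq_box N) * L2_set (\<lambda>n. norm (S n)) (freq_box N)"
    by (rule L2_set_mult_ineq)
  also have "\<dots> = sqrt (\<Sum>n\<in>freq_box N. (norm (S n))\<^sup>2)"
    unfolding L2_set_def b by simp
  finally have "(lam * real (card G))\<^sup>2 \<le> (sqrt (\<Sum>n\<in>freq_box N. (norm (S n))\<^sup>2))\<^sup>2"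
    using lam by (intro power_mono) auto
  also have "\<dots> = (\<Sum>n\<in>freq_box N. (norm (S n))\<^sup>2)"
    by (simp add: sum_nonneg)
  finally have "real N ^ ?d * (lam * real (card G))\<^sup>2 \<le> real N ^ ?d * (\<Sum>n\<in>freq_box N. (norm (S n))\<^sup>2)"
    by (intro mult_left_mono) auto
  also have "\<dots> \<le> (\<Sum>n\<in>freq_box N. of_int (\<Prod>j\<in>UNIV. tent N (n $ j)) * (norm (S n))\<^sup>2)"
    unfolding sum_distrib_left
  proof (intro sum_mono mult_right_mono)
    fix n :: "int ^ 'd" assume "n \<in> freq_box N"
    then have "(\<Prod>j\<in>(UNIV :: 'd set). int N) \<le> (\<Prod>j\<in>UNIV. tent N (n $ j))"
      by (intro prod_mono conjI tent_ge) (auto simp: freq_box_def)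
    then have "real_of_int (\<Prod>j\<in>(UNIV :: 'd set). int N) \<le> of_int (\<Prod>j\<in>UNIV. tent N (n $ j))"
      unfolding of_int_le_iff .
    then show "real N ^ ?d \<le> of_int (\<Prod>j\<in>UNIV. tent N (n $ j))" by simp
  qed simp
  \<comment> \<open>Since N < K, the frequency box lies inside the window of residues; the added
    terms are nonnegative.\<close>
  also have "\<dots> \<le> (\<Sum>n\<in>vec_box ?K. of_int (\<Prod>j\<in>UNIV. tent N (n $ j)) * (norm (S n))\<^sup>2)"
  proof (rule sum_mono2)
    show "(freq_box N :: (int ^ 'd) set) \<subseteq> vec_box ?K"
    proof
      fix n :: "int ^ 'd" assume "n \<in> freq_box N"
      then have "\<bar>n $ j\<bar> \<le> int N" for j by (simp add: freq_box_def)
      then have "n $ j \<in> ?K" for j using M(3) by (smt (verit) atLeastLessThan_iff of_nat_less_iff)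
      then show "n \<in> vec_box ?K" by (simp add: vec_box_def)
    qed
    show "0 \<le> of_int (\<Prod>j\<in>UNIV. tent N (n $ j)) * (norm (S n))\<^sup>2" for n
      by (simp add: prod_nonneg tent_nonneg)
  qed (simp add: finite_vec_box)
  finally have "real (card I) * (real N ^ ?d * (lam * real (card G))\<^sup>2)
      \<le> real (card I) * (\<Sum>n\<in>vec_box ?K. of_int (\<Prod>j\<in>UNIV. tent N (n $ j)) * (norm (S n))\<^sup>2)"
    by (intro mult_left_mono) auto
  also have "\<dots> \<le> real M * \<kappa> ^ ?d * (real (card G))\<^sup>2 + \<eta> * (2 * real N) ^ ?d * real M ^ (?d + 1) * real (card G)"
    unfolding S_def by (rule dual_inequality[OF M(1,2) G c fin inj kernel fourier \<eta> \<kappa>])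
  finally show ?thesis .
qed

section \<open>From the grid to the torus\<close>

definition grid_point :: "nat \<Rightarrow> (int ^ 'd::finite) \<times> int \<Rightarrow> (real ^ 'd) \<times> real" where
  "grid_point M p = ((\<chi> j. of_int (fst p $ j) / real M), of_int (snd p) / real M)"

text \<open>The measure of E is at most the integral, over one cell of volume M^-(d+1), of the
  number of points of the translated grid in E. Hence the count is required for every translate
  z.\<close>

lemma measure_le_grid_count:
  fixes E :: "((real ^ 'd::finite) \<times> real) set"
  assumes E: "E \<in> sets borel" "E \<subseteq> torus" and M: "M > 0" and R: "R \<ge> 0"
    and count: "\<And>z. real (card {p \<in> vec_box {0..<int M} \<times> {0..<int M}. grid_point M p + z \<in> E}) \<le> R"
  shows "measure lebesgue E * real M ^ (CARD('d) + 1) \<le> R"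
proof -
  define B where "B = (vec_box {0..<int M} \<times> {0..<int M} :: ((int ^ 'd) \<times> int) set)"
  have finB: "finite B" by (simp add: B_def finite_vec_box)
  define u :: "(real ^ 'd) \<times> real" where "u = ((\<chi> j. 1 / real M), 1 / real M)"
  \<comment> \<open>The cell is closed, so neighbouring translates overlap on faces; only the
    covering property enters, as an inequality.\<close>
  define C where "C = cbox (0 :: (real ^ 'd) \<times> real) u"
  have u_inner: "u \<bullet> b = 1 / real M" if "b \<in> Basis" for b :: "(real ^ 'd) \<times> real"
    using that by (auto simp: Basis_prod_def u_def inner_Pair Basis_vec_def inner_axis)
  have "emeasure lborel C = ennreal (\<Prod>b\<in>Basis. (u - 0) \<bullet> b)"
    unfolding C_def using M by (intro emeasure_lborel_cbox) (simp add: u_inner)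
  also have "(\<Prod>b\<in>Basis. (u - 0) \<bullet> b) = (1 / real M) ^ (CARD('d) + 1)"
    by (simp add: u_inner)
  finally have emC: "emeasure lborel C = ennreal ((1 / real M) ^ (CARD('d) + 1))" .
  have cover: "\<exists>p\<in>B. z - grid_point M p \<in> C" if z: "z \<in> E" for z
  proof -
    have t: "0 \<le> fst z $ j" "fst z $ j < 1" "0 \<le> snd z" "snd z < 1" for j
      using z E(2) by (auto simp: torus_def)
    \<comment> \<open>The strict bound r < 1 keeps the floor below M, so the base point stays in the
      index box.\<close>
    have fl: "\<lfloor>real M * r\<rfloor> \<in> {0..<int M} \<and> 0 \<le> r - of_int \<lfloor>real M * r\<rfloor> / real M
        \<and> r - of_int \<lfloor>real M * r\<rfloor> / real M \<le> 1 / real M" if "0 \<le> r" "r < 1" for r :: real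
    proof -
      have "real M * r < real M" "0 \<le> real M * r" using that M by simp_all
      then have "\<lfloor>real M * r\<rfloor> \<in> {0..<int M}" by (simp add: floor_less_iff)
      moreover have "of_int \<lfloor>real M * r\<rfloor> \<le> real M * r" "real M * r \<le> of_int \<lfloor>real M * r\<rfloor> + 1" by linarith+
      moreover have eq: "r - of_int \<lfloor>real M * r\<rfloor> / real M = (real M * r - of_int \<lfloor>real M * r\<rfloor>) / real M"
        using M by (simp add: diff_divide_distrib)
      ultimately show ?thesis
        unfolding eq by (auto intro!: divide_right_mono) linarith
    qed
    define p where "p = ((\<chi> j. \<lfloor>real M * (fst z $ j)\<rfloor>) :: int ^ 'd, \<lfloor>real M * snd z\<rfloor>)"
    have "p \<in> B"
      using fl[OF t(1,2)] fl[OF t(3,4)] by (simp add: B_def p_def vec_box_def)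
    moreover have "z - grid_point M p \<in> C"
    proof -
      have "0 \<le> (z - grid_point M p) \<bullet> b \<and> (z - grid_point M p) \<bullet> b \<le> 1 / real M" if "b \<in> Basis" for b
        using that fl[OF t(1,2)] fl[OF t(3,4)]
        by (auto simp: Basis_prod_def inner_Pair Basis_vec_def inner_axis p_def grid_point_def minus_prod_def)
      then show ?thesis unfolding C_def by (simp add: mem_box u_inner)
    qed
    ultimately show ?thesis by blast
  qed
  have [measurable]: "E \<in> sets borel" "C \<in> sets borel" using E by (auto simp: C_def)
  have "emeasure lborel E = (\<integral>\<^sup>+z. indicator E z \<partial>lborel)" using E by simp
  also have "\<dots> \<le> (\<integral>\<^sup>+z. (\<Sum>p\<in>B. indicator E z * indicator C (z - grid_point M p)) \<partial>lborel)"
  proof (rule nn_integral_mono)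
    fix z
    show "indicator E z \<le> (\<Sum>p\<in>B. indicator E z * indicator C (z - grid_point M p) :: ennreal)"
    proof (cases "z \<in> E")
      case True
      then obtain p where p: "p \<in> B" "z - grid_point M p \<in> C" using cover by blast
      have "indicator E z * indicator C (z - grid_point M p) \<le> (\<Sum>p\<in>B. indicator E z * indicator C (z - grid_point M p) :: ennreal)"
        using finB p(1) by (intro member_le_sum) auto
      then show ?thesis using True p(2) by simp
    qed simp
  qed
  also have "\<dots> = (\<Sum>p\<in>B. \<integral>\<^sup>+z. indicator E z * indicator C (z - grid_point M p) \<partial>lborel)"
    by (rule nn_integral_sum) measurable
  also have "\<dots> = (\<Sum>p\<in>B. \<integral>\<^sup>+z. indicator E (grid_point M p + z) * indicator C z \<partial>lborel)"
  proof (intro sum.cong refl)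
    fix p
    have "(\<integral>\<^sup>+z. indicator E z * indicator C (z - grid_point M p) \<partial>lborel)
        = (\<integral>\<^sup>+z. indicator E z * indicator C (z - grid_point M p) \<partial>(distr lborel borel ((+) (grid_point M p))))"
      by (simp only: lborel_distr_plus)
    also have "\<dots> = (\<integral>\<^sup>+z. indicator E (grid_point M p + z) * indicator C z \<partial>lborel)"
      by (subst nn_integral_distr) auto
    finally show "(\<integral>\<^sup>+z. indicator E z * indicator C (z - grid_point M p) \<partial>lborel)
        = (\<integral>\<^sup>+z. indicator E (grid_point M p + z) * indicator C z \<partial>lborel)" .
  qed
  also have "\<dots> = (\<integral>\<^sup>+z. (\<Sum>p\<in>B. indicator E (grid_point M p + z) * indicator C z) \<partial>lborel)"
    by (rule nn_integral_sum[symmetric]) measurable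
  also have "\<dots> \<le> (\<integral>\<^sup>+z. ennreal R * indicator C z \<partial>lborel)"
  proof (rule nn_integral_mono)
    fix z
    have "(\<Sum>p\<in>B. indicator E (grid_point M p + z) :: ennreal) = of_nat (card {p\<in>B. grid_point M p + z \<in> E})"
      using finB by (simp add: indicator_def Int_def)
    also have "\<dots> = ennreal (real (card {p\<in>B. grid_point M p + z \<in> E}))" by (simp add: ennreal_of_nat_eq_real_of_nat)
    also have "\<dots> \<le> ennreal R" unfolding B_def by (rule ennreal_leI[OF count])
    finally have "(\<Sum>p\<in>B. indicator E (grid_point M p + z)) * indicator C z \<le> ennreal R * indicator C z"
      by (intro mult_right_mono) auto
    then show "(\<Sum>p\<in>B. indicator E (grid_point M p + z) * indicator C z) \<le> ennreal R * indicator C z"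
      by (simp add: sum_distrib_right)
  qed
  also have "\<dots> = ennreal R * emeasure lborel C"
    by (rule nn_integral_cmult_indicator) simp
  also have "\<dots> = ennreal (R * (1 / real M) ^ (CARD('d) + 1))"
    unfolding emC using R by (intro ennreal_mult[symmetric]) auto
  finally have "emeasure lborel E \<le> ennreal (R * (1 / real M) ^ (CARD('d) + 1))" .
  then have "measure lborel E \<le> R * (1 / real M) ^ (CARD('d) + 1)"
    unfolding measure_def using R by (intro enn2real_leI) auto
  moreover have "measure lebesgue E = measure lborel E"
    using E by (simp add: measure_completion)
  ultimately show ?thesis
    using M by (simp add: power_one_over field_simps)
qed

section \<open>Exponential sums on translated grids and the measure bound\<close>

lemma exp_eq_e2pi: "exp (2 * of_real pi * \<i> * of_real r) = e2pi r"
  unfolding e2pi_def cis_conv_exp by (rule arg_cong[of _ _ exp]) (simp add: mult_ac)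

lemma exp_sum_eq:
  "exp_sum N a x t = (\<Sum>n\<in>freq_box N. a n * e2pi (int_dot n x + of_int (int_norm_sq n) * t))"
proof -
  have "exp (2 * of_real pi * \<i> * of_int (int_norm_sq n) * of_real t) = e2pi (of_int (int_norm_sq n) * t)"
    for n :: "int ^ 'a"
    unfolding exp_eq_e2pi[symmetric] by (simp add: mult.assoc)
  then show ?thesis
    unfolding exp_sum_def exp_eq_e2pi by (simp only: e2pi_add mult.assoc)
qed

text \<open>Translating the grid by z only multiplies the coefficients by unimodular factors. Their
  l2 norm is unchanged, so the grid estimate holds for all translates with the same
  constant.\<close>

lemma exp_sum_grid_point:
  fixes a :: "int ^ 'd::finite \<Rightarrow> complex"
  assumes "w = grid_point M p + z"
  shows "exp_sum N a (fst w) (snd w)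
    = (\<Sum>n\<in>freq_box N. (a n * e2pi (int_dot n (fst z) + of_int (int_norm_sq n) * snd z))
        * e2pi (of_int (int_inner n (fst p) + int_norm_sq n * snd p) / real M))"
  unfolding exp_sum_eq
proof (intro sum.cong refl)
  fix n :: "int ^ 'd"
  have "int_dot n (fst w) = int_dot n (fst z) + of_int (int_inner n (fst p)) / real M"
    unfolding assms by (simp add: int_dot_def int_inner_def grid_point_def distrib_left sum.distrib sum_divide_distrib)
  moreover have "of_int (int_norm_sq n) * snd w = of_int (int_norm_sq n) * snd z + of_int (int_norm_sq n * snd p) / real M"
    unfolding assms by (simp add: grid_point_def distrib_left)
  ultimately have "int_dot n (fst w) + of_int (int_norm_sq n) * snd w
      = (int_dot n (fst z) + of_int (int_norm_sq n) * snd z) + of_int (int_inner n (fst p) + int_norm_sq n * snd p) / real M"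
    by (simp add: add_divide_distrib)
  then show "a n * e2pi (int_dot n (fst w) + of_int (int_norm_sq n) * snd w)
    = (a n * e2pi (int_dot n (fst z) + of_int (int_norm_sq n) * snd z))
        * e2pi (of_int (int_inner n (fst p) + int_norm_sq n * snd p) / real M)"
    by (simp only: e2pi_add mult.assoc)
qed

text \<open>Cauchy-Schwarz over (2N+1)^d frequencies. From this bound on the level set is empty;
  below it lam^(4/d) <= 9 N^2, which converts powers of X into powers of N.\<close>

lemma norm_exp_sum_le:
  fixes a :: "int ^ 'd::finite \<Rightarrow> complex"
  assumes "(\<Sum>n\<in>freq_box N. (norm (a n))\<^sup>2) = 1"
  shows "norm (exp_sum N a x t) \<le> sqrt (real (2 * N + 1) ^ CARD('d))"
proof -
  have "freq_box N = (vec_box {- int N..int N} :: (int ^ 'd) set)"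
    by (auto simp: freq_box_def vec_box_def abs_le_iff minus_le_iff)
  then have card: "(\<Sum>n\<in>(freq_box N :: (int ^ 'd) set). 1) = real (2 * N + 1) ^ CARD('d)"
    using sum_vec_box_prod[of "{- int N..int N}" "\<lambda>(_ :: 'd) _. 1 :: real"] by (simp add: nat_add_distrib)
  have "norm (exp_sum N a x t) \<le> (\<Sum>n\<in>freq_box N. \<bar>norm (a n)\<bar> * \<bar>1 :: real\<bar>)"
    unfolding exp_sum_eq by (rule order_trans[OF norm_sum]) (simp add: norm_mult)
  also have "\<dots> \<le> L2_set (\<lambda>n. norm (a n)) (freq_box N) * L2_set (\<lambda>_. 1) (freq_box N :: (int ^ 'd) set)"
    by (rule L2_set_mult_ineq)
  also have "\<dots> = sqrt (real (2 * N + 1) ^ CARD('d))"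
    unfolding L2_set_def assms power_one card by simp
  finally show ?thesis .
qed

lemma arc_kernel_bound:
  fixes N X J M K :: nat
  assumes N: "N \<ge> 1" "64 * N \<le> X" and J: "J \<ge> 1" and M: "M = 4 * X\<^sup>2 * J" "M = 2 * K"
    and dvd: "\<And>q. 1 \<le> q \<Longrightarrow> q \<le> X \<Longrightarrow> q dvd M" and i: "i \<in> arc_index X J"
  shows "norm (\<Sum>m\<in>{- int K..<int K}. of_int (tent N m)
      * e2pi (of_int m * x + of_int (m\<^sup>2) * (of_int (arc_point M i) / real M))) \<le> 18 * real N * sqrt (real X)"
proof -
  obtain q a j where i_eq: "i = ((q, a), j)" by (metis prod.exhaust)
  have q: "X < 4 * q" "q \<le> X" and a: "coprime a q" and j: "\<bar>j\<bar> \<le> int J"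
    using i by (auto simp: i_eq arc_index_def denominators_def totatives_def)
  have X0: "X > 0" and q0: "q > 0" using N q by auto
  have M0: "M > 0" using M(1) X0 J by simp
  \<comment> \<open>The window of residues contains the support of the tent, so the sum over it is
    the full Weyl sum.\<close>
  have KN: "2 * N < K"
  proof -
    have "2 * X \<le> 2 * X * (X * J)" using X0 J by simp
    also have "\<dots> = K" using M by (simp add: power2_eq_square)
    finally show ?thesis using N by linarith
  qed
  have "q dvd M" using dvd q q0 by simp
  then have "real (M div q) = real M / real q" by (simp add: real_of_nat_div)
  then have "of_int (arc_point M i) / real M - of_int (int a) / real q = of_int j / real M"
    using M0 q0 by (simp add: i_eq arc_point_def field_simps)
  then have "\<bar>of_int (arc_point M i) / real M - of_int (int a) / real q\<bar> = \<bar>real_of_int j\<bar> / real M"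
    by simp
  also have "\<dots> \<le> real J / real M" using j M0 by (intro divide_right_mono) auto
  also have "\<dots> = 1 / (4 * (real X)\<^sup>2)" using J by (simp add: M(1))
  finally have near: "\<bar>of_int (arc_point M i) / real M - of_int (int a) / real q\<bar> \<le> 1 / (4 * (real X)\<^sup>2)" .
  have "(\<Sum>m\<in>{- int K..<int K}. of_int (tent N m)
        * e2pi (of_int m * x + of_int (m\<^sup>2) * (of_int (arc_point M i) / real M)))
      = (\<Sum>m\<in>{- 2 * int N..2 * int N}. of_int (tent N m)
        * e2pi (of_int m * x + of_int (m\<^sup>2) * (of_int (arc_point M i) / real M)))"
    using KN by (intro sum.mono_neutral_right) (auto simp: tent_def)
  then show ?thesis
    using weyl_sum_bound[OF N q _ near, of x] a by simp
qed

text \<open>Since card I >= M/24, the hypothesis \<open>X\<close> makes the kernel term at most half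
  of the left side of the large-values inequality; 48 is 2 * 24. The factor N^d is common to all
  terms and cancels.\<close>

lemma level_set_measure_bound:
  fixes a :: "int ^ 'd::finite \<Rightarrow> complex" and N X :: nat
  assumes N: "N \<ge> 1" "64 * N \<le> X" and lam: "lam > 0"
    and a: "(\<Sum>n\<in>freq_box N. (norm (a n))\<^sup>2) = 1"
    and C: "C > 0" "\<And>J M (k :: int). J \<ge> 1 \<Longrightarrow> M = 4 * X\<^sup>2 * J \<Longrightarrow>
      (\<forall>q. 1 \<le> q \<longrightarrow> q \<le> X \<longrightarrow> q dvd M) \<Longrightarrow> k \<noteq> 0 \<Longrightarrow> 2 * \<bar>k\<bar> \<le> int M \<Longrightarrow>
      norm (\<Sum>i\<in>arc_index X J. e2pi (of_int k * of_int (arc_point M i) / real M)) \<le> C * real M * real X powr (2 * \<delta> - 1)"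
    and X: "48 * (18 * sqrt (real X)) ^ CARD('d) \<le> lam\<^sup>2"
  shows "measure lebesgue (level_set N a lam) \<le> 48 * 2 ^ CARD('d) * C * real X powr (2 * \<delta> - 1) / lam\<^sup>2"
proof -
  let ?d = "CARD('d)"
  \<comment> \<open>The factorial makes every q <= X divide M, so all arc centres lie on the
    grid.\<close>
  define J :: nat where "J = fact X"
  define K where "K = 2 * X\<^sup>2 * J"
  define M where "M = 2 * K"
  have J: "J \<ge> 1" by (simp add: J_def Suc_leI)
  have X0: "X > 0" using N by linarith
  have M4: "M = 4 * X\<^sup>2 * J" by (simp add: M_def K_def)
  have M0: "M > 0" using M4 J X0 by simp
  have NK: "N < K"
  proof -
    have "X \<le> X * (2 * X * J)" using X0 J by simp
    also have "\<dots> = K" by (simp add: K_def power2_eq_square)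
    finally show ?thesis using N by linarith
  qed
  have dvd: "q dvd M" if "1 \<le> q" "q \<le> X" for q
    unfolding M4 J_def using that by (intro dvd_mult dvd_fact)
  define \<eta> where "\<eta> = C * real M * real X powr (2 * \<delta> - 1)"
  define \<kappa> where "\<kappa> = 18 * real N * sqrt (real X)"
  define B where "B = 48 * 2 ^ ?d * C * real X powr (2 * \<delta> - 1) / lam\<^sup>2"
  have B0: "B \<ge> 0" using C(1) by (simp add: B_def)
  have "measure lebesgue (level_set N a lam) * real M ^ (?d + 1) \<le> B * real M ^ (?d + 1)"
  proof (rule measure_le_grid_count)
    show "level_set N a lam \<in> sets borel" by (rule level_set_borel)
    show "level_set N a lam \<subseteq> torus" by (auto simp: level_set_def)
    show "0 \<le> B * real M ^ (?d + 1)" using B0 by simp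
    fix z :: "(real ^ 'd) \<times> real"
    define G where "G = {p \<in> vec_box {0..<int M} \<times> {0..<int M}. grid_point M p + z \<in> level_set N a lam}"
    define b where "b n = a n * e2pi (int_dot n (fst z) + of_int (int_norm_sq n) * snd z)" for n
    have "real (card (arc_index X J)) * (real N ^ ?d * (lam * real (card G))\<^sup>2)
      \<le> real M * \<kappa> ^ ?d * (real (card G))\<^sup>2 + \<eta> * (2 * real N) ^ ?d * real M ^ (?d + 1) * real (card G)"
    proof (rule grid_large_values[where b = b and \<tau> = "arc_point M" and K = K])
      show "M = 2 * K" "M > 0" "N < K" using M_def M0 NK by auto
      show "G \<subseteq> vec_box {0..<int M} \<times> {0..<int M}" by (auto simp: G_def)
      show "i = i'" if "i \<in> arc_index X J" "i' \<in> arc_index X J" "int M dvd arc_point M i - arc_point M i'" for i i'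
        using arc_point_inj[OF M4 J dvd that] .
      show "norm (\<Sum>m\<in>{- int K..<int K}. of_int (tent N m)
          * e2pi (of_int m * x + of_int (m\<^sup>2) * (of_int (arc_point M i) / real M))) \<le> \<kappa>"
        if "i \<in> arc_index X J" for i x
        unfolding \<kappa>_def by (rule arc_kernel_bound[OF N J M4 M_def dvd that])
      show "norm (\<Sum>i\<in>arc_index X J. e2pi (of_int k * of_int (arc_point M i) / real M)) \<le> \<eta>"
        if "k \<noteq> 0" "2 * \<bar>k\<bar> \<le> int M" for k
        unfolding \<eta>_def using dvd that by (intro C(2)[OF J M4]) auto
      show "\<eta> \<ge> 0" "\<kappa> \<ge> 0" "lam \<ge> 0" using C(1) lam by (auto simp: \<eta>_def \<kappa>_def)
      show "(\<Sum>n\<in>freq_box N. (norm (b n))\<^sup>2) = 1"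
        using a by (simp add: b_def norm_mult)
      show "lam < norm (\<Sum>n\<in>freq_box N. b n * e2pi (of_int (int_inner n (fst p) + int_norm_sq n * snd p) / real M))"
        if "p \<in> G" for p
      proof -
        have "lam < norm (exp_sum N a (fst w) (snd w))" if "w \<in> level_set N a lam" for w
          using that by (cases w) (auto simp: level_set_def)
        then have "lam < norm (exp_sum N a (fst (grid_point M p + z)) (snd (grid_point M p + z)))"
          using that unfolding G_def by blast
        then show ?thesis unfolding exp_sum_grid_point[OF refl] b_def .
      qed
    qed simp
    moreover define r where "r = real (card G)"
    ultimately have main: "real (card (arc_index X J)) * (real N ^ ?d * (lam * r)\<^sup>2)
      \<le> real M * \<kappa> ^ ?d * r\<^sup>2 + \<eta> * (2 * real N) ^ ?d * real M ^ (?d + 1) * r"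
      by simp
    have Nd: "real N ^ ?d > 0" using N by simp
    have "real M \<le> 24 * real (card (arc_index X J))"
      using card_arc_index_ge[OF M4] by (metis of_nat_le_iff of_nat_mult of_nat_numeral)
    then have "real M * (real N ^ ?d * (lam * r)\<^sup>2) \<le> 24 * real (card (arc_index X J)) * (real N ^ ?d * (lam * r)\<^sup>2)"
      by (intro mult_right_mono) auto
    also have "\<dots> \<le> 24 * (real M * \<kappa> ^ ?d * r\<^sup>2 + \<eta> * (2 * real N) ^ ?d * real M ^ (?d + 1) * r)"
      using main by (simp only: mult.assoc) simp
    also have "\<dots> = real M * real N ^ ?d * (24 * (18 * sqrt (real X)) ^ ?d * r\<^sup>2
        + 24 * 2 ^ ?d * C * real X powr (2 * \<delta> - 1) * real M ^ (?d + 1) * r)"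
      by (simp add: \<kappa>_def \<eta>_def power_mult_distrib algebra_simps)
    finally have "(real M * real N ^ ?d) * (lam * r)\<^sup>2 \<le> (real M * real N ^ ?d) * (24 * (18 * sqrt (real X)) ^ ?d * r\<^sup>2
        + 24 * 2 ^ ?d * C * real X powr (2 * \<delta> - 1) * real M ^ (?d + 1) * r)"
      by (simp only: mult.assoc)
    then have "(lam * r)\<^sup>2 \<le> 24 * (18 * sqrt (real X)) ^ ?d * r\<^sup>2
        + 24 * 2 ^ ?d * C * real X powr (2 * \<delta> - 1) * real M ^ (?d + 1) * r"
      using M0 Nd by (simp only: mult_le_cancel_left_pos mult_pos_pos of_nat_0_less_iff)
    \<comment> \<open>The quadratic term is absorbed here, and dividing by r leaves a bound linear
      in r.\<close>
    moreover have "24 * (18 * sqrt (real X)) ^ ?d * r\<^sup>2 \<le> lam\<^sup>2 / 2 * r\<^sup>2"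
      using X by (intro mult_right_mono) auto
    ultimately have "lam\<^sup>2 * r\<^sup>2 \<le> 48 * 2 ^ ?d * C * real X powr (2 * \<delta> - 1) * real M ^ (?d + 1) * r"
      by (simp add: power_mult_distrib)
    then have "r * (lam\<^sup>2 * r) \<le> r * (48 * 2 ^ ?d * C * real X powr (2 * \<delta> - 1) * real M ^ (?d + 1))"
      by (simp add: power2_eq_square mult_ac)
    moreover have "r \<ge> 0" by (simp add: r_def)
    ultimately have "lam\<^sup>2 * r \<le> 48 * 2 ^ ?d * C * real X powr (2 * \<delta> - 1) * real M ^ (?d + 1)"
      using C(1) by (cases "r = 0") (simp_all add: mult_le_cancel_left_pos)
    then have "r \<le> B * real M ^ (?d + 1)"
      using lam by (simp add: B_def pos_le_divide_eq mult_ac)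
    then show "real (card {p \<in> vec_box {0..<int M} \<times> {0..<int M}. grid_point M p + z \<in> level_set N a lam})
        \<le> B * real M ^ (?d + 1)"
      unfolding r_def G_def .
  qed (use M0 in auto)
  then show ?thesis using M0 by (simp add: B_def mult_le_cancel_right_pos del: times_divide_eq_left)
qed

theorem corollary1p1:
  fixes \<epsilon> :: real
  assumes "\<epsilon> > 0"
  shows "\<exists>C > 0. \<exists>C\<^sub>1 > 0.
    \<forall>(N :: nat) (a :: int ^ 'd::finite \<Rightarrow> complex) (lam :: real).
      N \<ge> 1 \<longrightarrow>
      (\<Sum>n\<in>freq_box N. (cmod (a n))\<^sup>2) = 1 \<longrightarrow>
      lam \<ge> C * real N powr (real CARD('d) / 4) \<longrightarrow>
      measure lebesgue (level_set N a lam)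
        \<le> C\<^sub>1 * real N powr \<epsilon> * lam powr (- (2 * (real CARD('d) + 2) / real CARD('d)))"
proof -
  let ?d = "CARD('d)"
  define d where "d = real ?d"
  have d: "d \<ge> 1" by (simp add: d_def Suc_leI)
  \<comment> \<open>As X will be at most 9 N^2, the loss X^(2 delta) is at most 9^(2 delta) N^(4
    delta); the cap at 1 bounds the constant by 81.\<close>
  define \<delta> where "\<delta> = min 1 (\<epsilon> / 4)"
  have \<delta>: "0 < \<delta>" "\<delta> \<le> 1" "4 * \<delta> \<le> \<epsilon>" using assms by (auto simp: \<delta>_def)
  obtain Cf where Cf: "Cf > 0" and Cf_bound: "\<And>(X :: nat) J M (k :: int). X \<ge> 1 \<Longrightarrow> J \<ge> 1 \<Longrightarrow> M = 4 * X\<^sup>2 * J \<Longrightarrow>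
      (\<forall>q. 1 \<le> q \<longrightarrow> q \<le> X \<longrightarrow> q dvd M) \<Longrightarrow> k \<noteq> 0 \<Longrightarrow> 2 * \<bar>k\<bar> \<le> int M \<Longrightarrow>
      norm (\<Sum>i\<in>arc_index X J. e2pi (of_int k * of_int (arc_point M i) / real M))
        \<le> Cf * real M * real X powr (2 * \<delta> - 1)"
    using arc_fourier_bound[OF \<delta>(1,2)] by blast
  \<comment> \<open>Solves 48 * 18^d * c0^(d/2) = 1, which turns X <= c0 * lam^(4/d) into the
    absorption condition.\<close>
  define c0 :: real where "c0 = (48 * 18 ^ ?d) powr (- (2 / d))"
  have c0: "0 < c0" "c0 \<le> 1"
  proof -
    show "0 < c0" by (simp add: c0_def)
    have "(48 * 18 ^ ?d :: real) powr (- (2 / d)) \<le> (48 * 18 ^ ?d) powr 0"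
    proof (rule powr_mono)
      have "(1 :: real) \<le> 18 ^ ?d" by (rule one_le_power) simp
      then show "(1 :: real) \<le> 48 * 18 ^ ?d" by linarith
    qed (use d in simp)
    then show "c0 \<le> 1" by (simp add: c0_def)
  qed
  \<comment> \<open>With this choice the hypothesis on lam says c0 * lam^(4/d) >= 65 N; the surplus
    over 64 N pays for rounding down to the integer X.\<close>
  define C where "C = (65 / c0) powr (d / 4)"
  \<comment> \<open>81 bounds 9^(2 delta), and 2 / c0 comes from 1/X <= 2/Y.\<close>
  define C1 where "C1 = 48 * 2 ^ ?d * Cf * 81 * (2 / c0)"
  have C: "C > 0" and C1: "C1 > 0" using c0 Cf by (auto simp: C_def C1_def)
  have "measure lebesgue (level_set N a lam) \<le> C1 * real N powr \<epsilon> * lam powr (- (2 * (d + 2) / d))"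
    if N: "N \<ge> 1" and a: "(\<Sum>n\<in>freq_box N. (cmod (a n))\<^sup>2) = 1"
      and lam: "lam \<ge> C * real N powr (d / 4)" for N and a :: "int ^ 'd \<Rightarrow> complex" and lam
  proof (cases "lam \<ge> sqrt (real (2 * N + 1) ^ ?d)")
    case True
    then have "level_set N a lam = {}"
      using norm_exp_sum_le[OF a] by (auto simp: level_set_def not_less intro: order_trans)
    then show ?thesis using C1 by simp
  next
    case False
    have N0: "real N \<ge> 1" using N by simp
    have "0 < C * real N powr (d / 4)" using C N0 by simp
    then have lam0: "lam > 0" using lam by linarith
    define Y where "Y = c0 * lam powr (4 / d)"
    define X where "X = nat \<lfloor>Y\<rfloor>"
    have "(C * real N powr (d / 4)) powr (4 / d) \<le> lam powr (4 / d)"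
      using lam C d by (intro powr_mono2) auto
    moreover have "(C * real N powr (d / 4)) powr (4 / d) = 65 / c0 * real N"
      using c0 d N0 by (simp add: C_def powr_mult powr_powr)
    ultimately have "65 / c0 * real N \<le> lam powr (4 / d)" by simp
    then have Y65: "65 * real N \<le> Y" using c0 by (simp add: Y_def field_simps)
    have XY: "real X \<le> Y" "Y < real X + 1" using Y65 N0 unfolding X_def by linarith+
    have NX: "64 * N \<le> X"
    proof -
      have "real (64 * N) \<le> real X" using Y65 XY N0 by simp
      then show ?thesis by (simp only: of_nat_le_iff)
    qed
    have X1: "X \<ge> 1" using NX N by linarith
    have large: "48 * (18 * sqrt (real X)) ^ ?d \<le> lam\<^sup>2"
    proof -
      have "sqrt (real X) ^ ?d = real X powr (d / 2)"
        using X1 by (simp add: powr_half_sqrt[symmetric] d_def powr_power)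
      also have "\<dots> \<le> Y powr (d / 2)" using XY d by (intro powr_mono2) auto
      also have "\<dots> = c0 powr (d / 2) * (lam powr (4 / d)) powr (d / 2)"
        unfolding Y_def by (rule powr_mult)
      also have "c0 powr (d / 2) = (48 * 18 ^ ?d) powr (- 1)"
        unfolding c0_def powr_powr using d by simp
      also have "\<dots> = 1 / (48 * 18 ^ ?d)" by (simp add: powr_minus_divide)
      also have "(lam powr (4 / d)) powr (d / 2) = lam\<^sup>2"
        unfolding powr_powr using d lam0 by simp
      finally show ?thesis by (simp add: power_mult_distrib field_simps)
    qed
    have "measure lebesgue (level_set N a lam) \<le> 48 * 2 ^ ?d * Cf * real X powr (2 * \<delta> - 1) / lam\<^sup>2"
      by (rule level_set_measure_bound[OF N NX lam0 a Cf Cf_bound[OF X1] large])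
    also have "\<dots> = 48 * 2 ^ ?d * Cf * (real X powr (2 * \<delta>) / real X) / lam\<^sup>2"
      using X1 by (simp add: powr_diff)
    also have "\<dots> \<le> 48 * 2 ^ ?d * Cf * ((81 * real N powr \<epsilon>) * (2 / (c0 * lam powr (4 / d)))) / lam\<^sup>2"
    proof -
      have inv: "1 / real X \<le> 2 / (c0 * lam powr (4 / d))"
      proof -
        have "Y \<le> 2 * real X" using XY X1 by linarith
        then show ?thesis using X1 c0 lam0 unfolding Y_def by (simp add: field_simps)
      qed
      have "lam powr (4 / d) \<le> 9 * (real N)\<^sup>2"
      proof -
        have "lam \<le> sqrt (real (2 * N + 1) ^ ?d)" using False by simp
        also have "\<dots> \<le> sqrt ((3 * real N) ^ ?d)" using N0 by (intro real_sqrt_le_mono power_mono) auto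
        also have "\<dots> = (3 * real N) powr (d / 2)"
        proof -
          have "(3 * real N) ^ ?d = (3 * real N) powr d"
            unfolding d_def using N0 by (intro powr_realpow[symmetric]) auto
          then have "sqrt ((3 * real N) ^ ?d) = ((3 * real N) powr d) powr (1 / 2)"
            by (simp only: powr_half_sqrt powr_ge_zero)
          then show ?thesis unfolding powr_powr by simp
        qed
        finally have "lam powr (4 / d) \<le> ((3 * real N) powr (d / 2)) powr (4 / d)"
          using lam0 d by (intro powr_mono2) auto
        also have "\<dots> = (3 * real N) powr 2" using d by (simp add: powr_powr)
        also have "\<dots> = 9 * (real N)\<^sup>2" using N0 by (simp add: power_mult_distrib)
        finally show ?thesis .
      qed
      then have "Y \<le> 1 * (9 * (real N)\<^sup>2)"
        unfolding Y_def using c0 by (intro mult_mono) auto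
      then have "real X powr (2 * \<delta>) \<le> (9 * (real N)\<^sup>2) powr (2 * \<delta>)"
        using XY \<delta> by (intro powr_mono2) auto
      also have "\<dots> = 9 powr (2 * \<delta>) * real N powr (4 * \<delta>)"
      proof -
        have "(real N)\<^sup>2 powr (2 * \<delta>) = (real N powr 2) powr (2 * \<delta>)" using N0 by simp
        then show ?thesis by (simp only: powr_mult powr_powr) simp
      qed
      also have "\<dots> \<le> 9 powr 2 * real N powr \<epsilon>"
        using \<delta> N0 by (intro mult_mono powr_mono) auto
      also have "(9 :: real) powr 2 = 81" by simp
      finally have "real X powr (2 * \<delta>) * (1 / real X) \<le> (81 * real N powr \<epsilon>) * (2 / (c0 * lam powr (4 / d)))"
        using inv by (intro mult_mono) auto
      then show ?thesis
        using Cf by (intro divide_right_mono mult_left_mono) auto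
    qed
    also have "\<dots> = C1 * real N powr \<epsilon> * (1 / (lam powr (4 / d) * lam\<^sup>2))"
      by (simp add: C1_def)
    also have "1 / (lam powr (4 / d) * lam\<^sup>2) = lam powr (- (2 * (d + 2) / d))"
    proof -
      \<comment> \<open>The exponent 4/d comes from 1/X and the exponent 2 from the division by
        lam^2.\<close>
      have "- (2 * (d + 2) / d) = - (4 / d + 2)" using d by (simp add: field_simps)
      then have "lam powr (- (2 * (d + 2) / d)) = 1 / lam powr (4 / d + 2)"
        by (simp only: powr_minus_divide)
      then show ?thesis using lam0 by (simp add: powr_add)
    qed
    finally show ?thesis .
  qed
  then show ?thesis using C C1 unfolding d_def by blast
qed

end
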